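(* Let $\mathcal{P}$ be a finite classical polar space over $\mathbb{F}_q$ of Witt index $d\ge 1$ with parameter $e$, and let $\Gamma(q,d,e)$ be the associated dual polar graph. Then the metric dimension of $\Gamma(q,d,e)$ is at most the rank over $\mathbb{R}$ of the incidence matrix of $\mathcal{P}$; that is, it is at most \[ \frac{(q^{d+e-1}+1)(q^{d+e-1}-q^{e-1}+q-1)}{(q^{e-1}+1)(q-1)}. \]
   Context: Let $V(n,q)$ be an $n$-dimensional vector space over the finite field $\mathbb{F}_q$ equipped with a non-degenerate symplectic, quadratic or Hermitian form. A subspace is totally isotropic if the form (sesquilinear form, or quadratic form in the quadratic case) vanishes identically on it. The (classical) polar space $\mathcal{P}$ is the collection of all totally isotropic subspaces; its Witt index $d$ is the largest dimension of a totally isotropic subspace. Points of $\mathcal{P}$ are the $1$-dimensional totally isotropic subspaces, and generators are the $d$-dimensional totally isotropic subspaces. The parameter $e$ depends on the type: symplectic $Sp(2d,q)$ on $V(2d,q)$: $e=1$; parabolic quadric $\Omega(2d+1,q)$ on $V(2d+1,q)$: $e=1$; hyperbolic quadric $\Omega^+(2d,q)$ on $V(2d,q)$: $e=0$; elliptic quadric $\Omega^-(2d+2,q)$ on $V(2d+2,q)$: $e=2$; Hermitian $U(2d+1,q)$ on $V(2d+1,q)$ ($q$ a square): $e=3/2$; Hermitian $U(2d,q)$ on $V(2d,q)$ ($q$ a square): $e=1/2$. The incidence matrix of $\mathcal{P}$ is the $0/1$ matrix with rows indexed by generators and columns by points, with $(U,x)$-entry $1$ iff $x\subseteq U$. The dual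 polar graph $\Gamma(q,d,e)$ has the generators of $\mathcal{P}$ as vertices, two generators being adjacent iff their intersection has dimension $d-1$. For a finite connected graph, a resolving set is a set $S$ of vertices such that for any two distinct vertices $u,w$ there is $x\in S$ with $d(u,x)\ne d(w,x)$ (graph distance); the metric dimension is the minimum size of a resolving set. *)

theory Defs
  imports Complex_Main "HOL-Library.Function_Algebras" "HOL-Library.Cardinality"
begin

text \<open>The field F_q is a finite field type 'a (so q = CARD('a)); the vector space
  V(n,q) is the function space 'n \<Rightarrow> 'a with 'n a finite index type (n = CARD('n)),
  with pointwise addition and the following scalar multiplication.\<close>

definition fscale :: "'a::field \<Rightarrow> ('n \<Rightarrow> 'a) \<Rightarrow> ('n \<Rightarrow> 'a)" where
  "fscale c v = (\<lambda>i. c * v i)"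

abbreviation lsubspace :: "('n \<Rightarrow> 'a::field) set \<Rightarrow> bool" where
  "lsubspace W \<equiv> Modules.module.subspace (fscale :: 'a \<Rightarrow> _) W"

abbreviation ldim :: "('n \<Rightarrow> 'a::field) set \<Rightarrow> nat" where
  "ldim W \<equiv> Vector_Spaces.vector_space.dim (fscale :: 'a \<Rightarrow> _) W"

definition sesquilinear :: "('a::field \<Rightarrow> 'a) \<Rightarrow> (('n \<Rightarrow> 'a) \<Rightarrow> ('n \<Rightarrow> 'a) \<Rightarrow> 'a) \<Rightarrow> bool" where
  "sesquilinear \<sigma> B \<longleftrightarrow>
     (\<forall>u v w. B (u + v) w = B u w + B v w) \<and>
     (\<forall>u v w. B u (v + w) = B u v + B u w) \<and>
     (\<forall>c u v. B (fscale c u) v = c * B u v) \<and>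
     (\<forall>c u v. B u (fscale c v) = \<sigma> c * B u v)"

definition nondegenerate :: "(('n \<Rightarrow> 'a::field) \<Rightarrow> ('n \<Rightarrow> 'a) \<Rightarrow> 'a) \<Rightarrow> bool" where
  "nondegenerate B \<longleftrightarrow> (\<forall>u. (\<forall>v. B u v = 0) \<longrightarrow> u = 0)"

definition polar_of :: "(('n \<Rightarrow> 'a::field) \<Rightarrow> 'a) \<Rightarrow> ('n \<Rightarrow> 'a) \<Rightarrow> ('n \<Rightarrow> 'a) \<Rightarrow> 'a" where
  "polar_of Q u v = Q (u + v) - Q u - Q v"

definition field_involution :: "('a::field \<Rightarrow> 'a) \<Rightarrow> bool" where
  "field_involution \<sigma> \<longleftrightarrow>
     (\<forall>a b. \<sigma> (a + b) = \<sigma> a + \<sigma> b) \<and> (\<forall>a b. \<sigma> (a * b) = \<sigma> a * \<sigma> b) \<and>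
     (\<forall>a. \<sigma> (\<sigma> a) = a) \<and> \<sigma> \<noteq> id"

datatype ('a, 'n) polar_form =
    Symplectic "('n \<Rightarrow> 'a) \<Rightarrow> ('n \<Rightarrow> 'a) \<Rightarrow> 'a"
  | Quadratic "('n \<Rightarrow> 'a) \<Rightarrow> 'a"
  | Hermitian "'a \<Rightarrow> 'a" "('n \<Rightarrow> 'a) \<Rightarrow> ('n \<Rightarrow> 'a) \<Rightarrow> 'a"

fun valid_form :: "('a::field, 'n) polar_form \<Rightarrow> bool" where
  "valid_form (Symplectic B) \<longleftrightarrow>
     sesquilinear id B \<and> (\<forall>v. B v v = 0) \<and> nondegenerate B"
| "valid_form (Quadratic Q) \<longleftrightarrow>
     (\<forall>c v. Q (fscale c v) = c ^ 2 * Q v) \<and> sesquilinear id (polar_of Q) \<and>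
     (\<forall>v. Q v = 0 \<and> (\<forall>w. polar_of Q v w = 0) \<longrightarrow> v = 0)"
| "valid_form (Hermitian \<sigma> h) \<longleftrightarrow>
     field_involution \<sigma> \<and> sesquilinear \<sigma> h \<and> (\<forall>u v. h v u = \<sigma> (h u v)) \<and> nondegenerate h"

fun tot_iso :: "('a::field, 'n) polar_form \<Rightarrow> ('n \<Rightarrow> 'a) set \<Rightarrow> bool" where
  "tot_iso (Symplectic B) W \<longleftrightarrow> (\<forall>u\<in>W. \<forall>v\<in>W. B u v = 0)"
| "tot_iso (Quadratic Q) W \<longleftrightarrow> (\<forall>v\<in>W. Q v = 0)"
| "tot_iso (Hermitian \<sigma> h) W \<longleftrightarrow> (\<forall>u\<in>W. \<forall>v\<in>W. h u v = 0)"

definition ti_subspaces :: "('a::field, 'n) polar_form \<Rightarrow> ('n \<Rightarrow> 'a) set set" where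
  "ti_subspaces F = {W. lsubspace W \<and> tot_iso F W}"

definition witt_index :: "('a::field, 'n) polar_form \<Rightarrow> nat" where
  "witt_index F = Max (ldim ` ti_subspaces F)"

definition polar_points :: "('a::field, 'n) polar_form \<Rightarrow> ('n \<Rightarrow> 'a) set set" where
  "polar_points F = {W \<in> ti_subspaces F. ldim W = 1}"

definition generators :: "('a::field, 'n) polar_form \<Rightarrow> ('n \<Rightarrow> 'a) set set" where
  "generators F = {W \<in> ti_subspaces F. ldim W = witt_index F}"

text \<open>The parameter e, according to the type of the polar space
  (n = dimension of V, d = Witt index):
  Sp(2d,q): e = 1; Omega(2d+1,q): 1; Omega+(2d,q): 0; Omega-(2d+2,q): 2;
  U(2d+1,q): 3/2; U(2d,q): 1/2.\<close>
fun polar_e :: "('a::{field,finite}, 'n::finite) polar_form \<Rightarrow> real" where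
  "polar_e (Symplectic B) = 1"
| "polar_e (Quadratic Q) =
     (if CARD('n) = 2 * witt_index (Quadratic Q) + 1 then 1
      else if CARD('n) = 2 * witt_index (Quadratic Q) then 0 else 2)"
| "polar_e (Hermitian \<sigma> h) =
     (if CARD('n) = 2 * witt_index (Hermitian \<sigma> h) + 1 then 3 / 2 else 1 / 2)"

definition incidence :: "('a::field, 'n) polar_form \<Rightarrow> ('n \<Rightarrow> 'a) set \<Rightarrow> ('n \<Rightarrow> 'a) set \<Rightarrow> real" where
  "incidence F U x = (if x \<subseteq> U then 1 else 0)"

definition rows_independent :: "('a::field, 'n) polar_form \<Rightarrow> ('n \<Rightarrow> 'a) set set \<Rightarrow> bool" where
  "rows_independent F S \<longleftrightarrow>
     (\<forall>c :: ('n \<Rightarrow> 'a) set \<Rightarrow> real.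
        (\<forall>x \<in> polar_points F. (\<Sum>U\<in>S. c U * incidence F U x) = 0) \<longrightarrow> (\<forall>U\<in>S. c U = 0))"

definition incidence_rank :: "('a::field, 'n) polar_form \<Rightarrow> nat" where
  "incidence_rank F = Max {card S | S. S \<subseteq> generators F \<and> rows_independent F S}"

inductive walk :: "'v set \<Rightarrow> ('v \<Rightarrow> 'v \<Rightarrow> bool) \<Rightarrow> nat \<Rightarrow> 'v \<Rightarrow> 'v \<Rightarrow> bool"
  for V E where
  walk0: "u \<in> V \<Longrightarrow> walk V E 0 u u"
| walkS: "u \<in> V \<Longrightarrow> E u v \<Longrightarrow> walk V E k v w \<Longrightarrow> walk V E (Suc k) u w"

definition gdist :: "'v set \<Rightarrow> ('v \<Rightarrow> 'v \<Rightarrow> bool) \<Rightarrow> 'v \<Rightarrow> 'v \<Rightarrow> nat" where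
  "gdist V E u w = (LEAST k. walk V E k u w)"

definition resolving_set :: "'v set \<Rightarrow> ('v \<Rightarrow> 'v \<Rightarrow> bool) \<Rightarrow> 'v set \<Rightarrow> bool" where
  "resolving_set V E S \<longleftrightarrow> S \<subseteq> V \<and>
     (\<forall>u\<in>V. \<forall>w\<in>V. u \<noteq> w \<longrightarrow> (\<exists>x\<in>S. gdist V E u x \<noteq> gdist V E w x))"

definition metric_dimension :: "'v set \<Rightarrow> ('v \<Rightarrow> 'v \<Rightarrow> bool) \<Rightarrow> nat" where
  "metric_dimension V E = Min {card S | S. resolving_set V E S}"

definition dual_polar_adj :: "('a::field, 'n) polar_form \<Rightarrow> ('n \<Rightarrow> 'a) set \<Rightarrow> ('n \<Rightarrow> 'a) set \<Rightarrow> bool" where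
  "dual_polar_adj F U W \<longleftrightarrow> U \<in> generators F \<and> W \<in> generators F \<and>
     ldim (U \<inter> W) = witt_index F - 1"

end

(* The number of points on the intersection of two generators, hence the inner product of their rows in
   the incidence matrix, depends only on their distance. If the rows of a set of generators span the
   row space, two generators at the same distances from all of them therefore have rows whose
   difference is orthogonal to the row space, so they coincide.

   For the rank, let x be a point and let p_x be the combination of the indicator of x, the
   indicator of the points not collinear with x and the constant 1 whose inner product with the row
   of every generator U is the (U,x)-entry. Expanding in an orthonormal basis of the row space gives,
   by Bessel, rank <= sum over x of |p_x|^2. Only the number of points and the number of points not
   collinear with a given one enter, and both follow by double counting. *)
theory Submission
  imports Defs "HOL-Analysis.Analysis"
begin

section \<open>Subspaces over a finite field\<close>

text \<open>The combination p_x comes from the collinearity graph. On points, let I, N and J be the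
  identity, the non-collinearity matrix and the all-one matrix. For d >= 2, off the constants, N has
  the eigenvalues -q^(d-1) and q^(d+e-2), that is -\<open>A\<close> and \<open>T\<close>, and the
  rows lie in the constants plus the eigenspace of -\<open>A\<close>. The projection onto that sum
  is (T I - N + c0 J) / (T + A); the p_x are its columns and the claimed bound is its trace. The
  proof checks its action on the rows and the norms of its columns. The counts involve only q, n, d
  and \<open>\<tau>\<close>, with q^e = \<tau> q^(n-2d). But \<open>polar_e\<close> is read off from
  n and d with catch-all branches, so n - 2d has to be bounded for each type of form. This amounts
  to bounding the dimension of anisotropic forms over finite fields, which is where squares and
  norms enter.\<close>

interpretation fs: vector_space "fscale :: 'a::field \<Rightarrow> ('n \<Rightarrow> 'a) \<Rightarrow> ('n \<Rightarrow> 'a)"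
  by standard (auto simp: fscale_def fun_eq_iff algebra_simps)

text \<open>The span of \<open>W\<close> and \<open>b\<close> when \<open>W\<close> is a subspace,
  written as an image of pairs so that its size follows from injectivity.\<close>

definition lext :: "('n \<Rightarrow> 'a::field) set \<Rightarrow> ('n \<Rightarrow> 'a) \<Rightarrow> ('n \<Rightarrow> 'a) set" where
  "lext W b = (\<lambda>(c, w). w + fscale c b) ` (UNIV \<times> W)"

lemma mem_lext: "v \<in> lext W b \<longleftrightarrow> (\<exists>c. \<exists>w\<in>W. v = w + fscale c b)"
  by (auto simp: lext_def)

lemma lext_alt: "lsubspace W \<Longrightarrow> lext W b = {v. \<exists>c. v - fscale c b \<in> W}"
  unfolding mem_lext set_eq_iff mem_Collect_eq
  by (metis add_diff_cancel_right' diff_add_cancel)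

lemma lsubspace_lext:
  assumes "lsubspace W" shows "lsubspace (lext W b)"
proof (rule fs.subspaceI)
  show "0 \<in> lext W b"
    unfolding mem_lext using fs.subspace_0[OF assms]
    by (intro exI[of _ 0] bexI[of _ 0]) auto
next
  fix x y assume "x \<in> lext W b" "y \<in> lext W b"
  then obtain c w c' w' where *: "w \<in> W" "w' \<in> W" "x = w + fscale c b" "y = w' + fscale c' b"
    by (auto simp: mem_lext)
  show "x + y \<in> lext W b"
    unfolding mem_lext using * fs.subspace_add[OF assms, of w w']
    by (intro exI[of _ "c + c'"] bexI[of _ "w + w'"]) (auto simp: fs.scale_left_distrib)
next
  fix k x assume "x \<in> lext W b"
  then obtain c w where *: "w \<in> W" "x = w + fscale c b"
    by (auto simp: mem_lext)
  show "fscale k x \<in> lext W b"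
    unfolding mem_lext using * fs.subspace_scale[OF assms, of w k]
    by (intro exI[of _ "k * c"] bexI[of _ "fscale k w"]) (auto simp: fs.scale_right_distrib)
qed

lemma subset_lext: "W \<subseteq> lext W b"
  by (auto simp: mem_lext intro!: exI[of _ 0])

lemma mem_lext_self: "lsubspace W \<Longrightarrow> b \<in> lext W b"
  unfolding mem_lext using fs.subspace_0[of W] by (intro exI[of _ 1] bexI[of _ 0]) auto

lemma lext_minimal: "lsubspace V \<Longrightarrow> W \<subseteq> V \<Longrightarrow> b \<in> V \<Longrightarrow> lext W b \<subseteq> V"
  by (auto simp: mem_lext intro!: fs.subspace_add fs.subspace_scale)

lemma card_lext:
  fixes W :: "('n::finite \<Rightarrow> 'a::{field,finite}) set"
  assumes W: "lsubspace W" and b: "b \<notin> W"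
  shows "card (lext W b) = CARD('a) * card W"
proof -
  have "inj_on (\<lambda>(c, w). w + fscale c b) (UNIV \<times> W)"
  proof (rule inj_onI, clarify)
    fix c w c' w' assume w: "w \<in> W" "w' \<in> W" and eq: "w + fscale c b = w' + fscale c' b"
    have "fscale (c - c') b = w' - w"
      using eq by (simp add: fs.scale_left_diff_distrib algebra_simps)
    hence *: "fscale (c - c') b \<in> W" using w fs.subspace_diff[OF W] by simp
    have "c = c'"
    proof (rule ccontr)
      assume "c \<noteq> c'"
      hence "b = fscale (1 / (c - c')) (fscale (c - c') b)" by simp
      thus False using fs.subspace_scale[OF W *, of "1 / (c - c')"] b by simp
    qed
    with eq show "c = c' \<and> w = w'" by simp
  qed
  thus ?thesis by (simp add: lext_def card_image card_cartesian_product)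
qed

text \<open>Each basis vector multiplies the size of the span by q. Through this, dimension
  arguments are run on cardinalities below.\<close>

lemma card_lsubspace:
  fixes W :: "('n::finite \<Rightarrow> 'a::{field,finite}) set"
  assumes "lsubspace W"
  shows "card W = CARD('a) ^ ldim W"
proof -
  have span: "card (fs.span B) = CARD('a) ^ card B"
    if "fs.independent B" for B :: "('n \<Rightarrow> 'a) set"
    using finite[of B] that
  proof (induction B)
    case empty
    show ?case by simp
  next
    case (insert b B)
    have "fs.span (insert b B) = lext (fs.span B) b"
      by (auto simp: fs.span_insert lext_alt)
    moreover have "b \<notin> fs.span B" "fs.independent B"
      using insert fs.independent_insert[of b B] by (auto split: if_splits)
    ultimately show ?case using insert by (simp add: card_lext)
  qed
  obtain B where B: "B \<subseteq> W" "fs.independent B" "W \<subseteq> fs.span B" "card B = ldim W"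
    using fs.basis_exists[of W] by blast
  have "fs.span B = W"
    using B assms by (metis fs.span_minimal subset_antisym)
  with span[OF B(2)] B(4) show ?thesis by simp
qed

lemma CARD_field_gt_1: "CARD('a::{field,finite}) > 1"
proof -
  have "card {0, 1 :: 'a} \<le> CARD('a)" by (intro card_mono) auto
  thus ?thesis by simp
qed

lemma ldim_eqI:
  fixes W :: "('n::finite \<Rightarrow> 'a::{field,finite}) set"
  assumes "lsubspace W" "card W = CARD('a) ^ k"
  shows "ldim W = k"
  using card_lsubspace[OF assms(1)] assms(2) CARD_field_gt_1[where 'a='a]
  by (metis power_inject_exp)

text \<open>Subtracting \<open>fscale (f w / f v) v\<close> moves any \<open>w\<close> into the
  kernel, so the kernel and \<open>v\<close> together span \<open>W\<close>.\<close>

lemma card_kernel: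
  fixes W :: "('n::finite \<Rightarrow> 'a::{field,finite}) set"
  assumes W: "lsubspace W"
    and add: "\<And>u v. f (u + v) = f u + f v" and scale: "\<And>c u. f (fscale c u) = c * f u"
    and v: "v \<in> W" "f v \<noteq> (0::'a)"
  shows "card W = CARD('a) * card {w \<in> W. f w = 0}"
proof -
  let ?K = "{w \<in> W. f w = 0}"
  have f0: "f 0 = 0" using scale[of 0 0] by simp
  have K: "lsubspace ?K"
    by (rule fs.subspaceI) 
      (use W in \<open>auto simp: f0 add scale fs.subspace_0 fs.subspace_add fs.subspace_scale\<close>)
  have fdiff: "f (x - y) = f x - f y" for x y
    using add[of "x - y" y] by simp
  have "lext ?K v = W"
  proof
    show "lext ?K v \<subseteq> W" using v W by (intro lext_minimal) auto
    show "W \<subseteq> lext ?K v"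
    proof
      fix w assume "w \<in> W"
      moreover have "fscale (f w / f v) v \<in> W" using v W by (simp add: fs.subspace_scale)
      ultimately have "w - fscale (f w / f v) v \<in> ?K"
        using v W by (simp add: fs.subspace_diff fdiff scale)
      thus "w \<in> lext ?K v" unfolding lext_alt[OF K] by blast
    qed
  qed
  with card_lext[OF K, of v] v show ?thesis by simp
qed

text \<open>Pairs with the same sum differ by an element of \<open>A \<inter> B\<close>, so the
  fibres of addition on \<open>A \<times> B\<close> have at most that size.\<close>

lemma card_Int_subspaces:
  fixes A :: "('n::finite \<Rightarrow> 'a::{field,finite}) set"
  assumes A: "lsubspace A" and B: "lsubspace B" and V: "lsubspace V" and sub: "A \<subseteq> V" "B \<subseteq> V"
  shows "card A * card B \<le> card (A \<inter> B) * card V"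
proof -
  have "card (A \<times> B) = (\<Sum>s\<in>V. card {p \<in> A \<times> B. fst p + snd p = s})"
    using sub by (subst card_eq_sum, subst sum.group[symmetric, where g="\<lambda>p. fst p + snd p" and T=V])
      (auto simp: card_eq_sum[symmetric] intro!: fs.subspace_add[OF V])
  also have "\<dots> \<le> (\<Sum>s\<in>V. card (A \<inter> B))"
  proof (rule sum_mono)
    fix s
    show "card {p \<in> A \<times> B. fst p + snd p = s} \<le> card (A \<inter> B)"
    proof (cases "{p \<in> A \<times> B. fst p + snd p = s} = {}")
      case False
      then obtain a b where ab: "a \<in> A" "b \<in> B" "a + b = s" by auto
      show ?thesis
      proof (rule card_inj_on_le[where f="\<lambda>p. fst p - a"])
        show "inj_on (\<lambda>p. fst p - a) {p \<in> A \<times> B. fst p + snd p = s}"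
          by (auto intro!: inj_onI)
        show "(\<lambda>p. fst p - a) ` {p \<in> A \<times> B. fst p + snd p = s} \<subseteq> A \<inter> B"
        proof
          fix z assume "z \<in> (\<lambda>p. fst p - a) ` {p \<in> A \<times> B. fst p + snd p = s}"
          then obtain x y where xy: "x \<in> A" "y \<in> B" "x + y = s" "z = x - a" by auto
          have "x - a = b - y" using xy ab by (simp add: algebra_simps)
          moreover have "x - a \<in> A" "b - y \<in> B" using xy ab A B by (auto intro: fs.subspace_diff)
          ultimately show "z \<in> A \<inter> B" using xy by simp
        qed
      qed simp
    next
      case True
      show ?thesis unfolding True by simp
    qed
  qed
  finally show ?thesis by (simp add: card_cartesian_product mult.commute)
qed

section \<open>Polar spaces\<close>

text \<open>The three types of forms are treated uniformly: \<open>S\<close> is the set of isotropic vectors, \<open>B\<close>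
  the (polarised) form, and \<open>\<tau>\<close> the number of isotropic vectors on an affine line \<open>v + \<langle>u\<rangle>\<close> with
  isotropic direction \<open>u\<close> not perpendicular to \<open>v\<close>, namely \<open>1\<close>, \<open>\<surd>q\<close> and \<open>q\<close> in the
  quadratic, Hermitian and symplectic case.\<close>

locale polar_space =
  fixes F :: "('a::{field,finite}, 'n::finite) polar_form"
    and B :: "('n \<Rightarrow> 'a) \<Rightarrow> ('n \<Rightarrow> 'a) \<Rightarrow> 'a"
    and S :: "('n \<Rightarrow> 'a) set"
    and \<tau> q n :: nat
  assumes CARD_a: "CARD('a) = q" and CARD_n: "CARD('n) = n"
    and B_add: "B (u + v) w = B u w + B v w"
    and B_scale: "B (fscale c u) w = c * B u w"
    and B_sym: "B u v = 0 \<Longrightarrow> B v u = 0"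
    and S_zero: "0 \<in> S"
    and S_scale: "u \<in> S \<Longrightarrow> fscale c u \<in> S"
    and S_add: "u \<in> S \<Longrightarrow> v \<in> S \<Longrightarrow> B u v = 0 \<Longrightarrow> u + v \<in> S"
    and S_self: "u \<in> S \<Longrightarrow> B u u = 0"
    and S_nondegenerate: "u \<in> S \<Longrightarrow> (\<And>v. B v u = 0) \<Longrightarrow> u = 0"
    and card_S_line: "u \<in> S \<Longrightarrow> B v u \<noteq> 0 \<Longrightarrow> card {a. v + fscale a u \<in> S} = \<tau>"
    and ti_eq: "ti_subspaces F = {W. lsubspace W \<and> W \<subseteq> S \<and> (\<forall>u\<in>W. \<forall>v\<in>W. B u v = 0)}"
begin

abbreviation "d \<equiv> witt_index F"

lemma q_gt_1: "q > 1"
  using CARD_field_gt_1[where 'a='a] by (simp add: CARD_a)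

lemmas card_lsubspace' = card_lsubspace[where ?'a='a and ?'n='n, unfolded CARD_a]
  and ldim_eqI' = ldim_eqI[where ?'a='a and ?'n='n, unfolded CARD_a]
  and card_lext' = card_lext[where ?'a='a and ?'n='n, unfolded CARD_a]
  and card_kernel' = card_kernel[where ?'a='a and ?'n='n, unfolded CARD_a]

lemma B_zero_left [simp]: "B 0 w = 0"
  using B_scale[of 0 0 w] by simp

lemma B_zero_right [simp]: "B w 0 = 0"
  by (rule B_sym) simp

lemma B_sym_iff: "B u v = 0 \<longleftrightarrow> B v u = 0"
  using B_sym by blast

lemma B_add_right: "B w u = 0 \<Longrightarrow> B w v = 0 \<Longrightarrow> B w (u + v) = 0"
  using B_sym_iff B_add by (metis add_0)

lemma B_scale_right: "B w (fscale c u) = 0 \<longleftrightarrow> c = 0 \<or> B w u = 0"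
  using B_sym_iff[of w] by (simp add: B_scale)

lemma lsubspace_perp: "lsubspace W \<Longrightarrow> lsubspace {w \<in> W. B w u = 0}"
  by (rule fs.subspaceI)
    (auto simp: B_add B_scale fs.subspace_0 fs.subspace_add fs.subspace_scale)

lemma card_perp:
  assumes "lsubspace W" "v \<in> W" "B v u \<noteq> 0"
  shows "card W = q * card {w \<in> W. B w u = 0}"
  using assms by (intro card_kernel'[where v=v]) (auto simp: B_add B_scale)

lemma card_perp_ge:
  assumes "lsubspace W"
  shows "card W \<le> q * card {w \<in> W. B w u = 0}"
proof (cases "\<exists>v\<in>W. B v u \<noteq> 0")
  case True
  thus ?thesis using card_perp[OF assms] by fastforce
next
  case False
  hence "{w \<in> W. B w u = 0} = W" by auto
  thus ?thesis using q_gt_1 by simp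
qed

definition ti :: "('n \<Rightarrow> 'a) set \<Rightarrow> bool" where
  "ti W \<longleftrightarrow> lsubspace W \<and> W \<subseteq> S \<and> (\<forall>u\<in>W. \<forall>v\<in>W. B u v = 0)"

lemma ti_iff: "W \<in> ti_subspaces F \<longleftrightarrow> ti W"
  by (simp add: ti_eq ti_def)

lemma ti_zero: "ti {0}"
  using S_zero by (auto simp: ti_def intro!: fs.subspaceI)

lemma ti_subset: "ti W \<Longrightarrow> lsubspace V \<Longrightarrow> V \<subseteq> W \<Longrightarrow> ti V"
  by (auto simp: ti_def)

lemma ti_lext:
  assumes W: "ti W" and w: "w \<in> S" "\<And>u. u \<in> W \<Longrightarrow> B u w = 0"
  shows "ti (lext W w)"
  unfolding ti_def
proof (intro conjI ballI subsetI)
  show "lsubspace (lext W w)" using W by (simp add: ti_def lsubspace_lext)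
next
  fix x assume "x \<in> lext W w"
  thus "x \<in> S" using W w by (auto simp: mem_lext ti_def B_scale_right intro!: S_add S_scale)
next
  fix x y assume "x \<in> lext W w" "y \<in> lext W w"
  then obtain a b u v where *: "u \<in> W" "v \<in> W" "x = u + fscale a w" "y = v + fscale b w"
    by (auto simp: mem_lext)
  have "B u v = 0" "B u w = 0" "B v w = 0" "B w w = 0" "B w v = 0"
    using * W w S_self B_sym by (auto simp: ti_def)
  thus "B x y = 0" using * by (simp add: B_add B_scale B_add_right B_scale_right)
qed

lemma ldim_ti_le: "ti W \<Longrightarrow> ldim W \<le> d"
  unfolding witt_index_def by (intro Max_ge) (auto simp: ti_iff)

lemma generators_iff: "U \<in> generators F \<longleftrightarrow> ti U \<and> card U = q ^ d"
proof -
  have "ldim U = d \<longleftrightarrow> card U = q ^ d" if "ti U"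
    using that card_lsubspace'[of U] ldim_eqI'[of U d] unfolding ti_def by metis
  thus ?thesis unfolding generators_def mem_Collect_eq ti_iff by blast
qed

lemma ti_generator: "U \<in> generators F \<Longrightarrow> ti U"
  by (simp add: generators_iff)

lemma card_generator: "U \<in> generators F \<Longrightarrow> card U = q ^ d"
  by (simp add: generators_iff)

lemma lsubspace_generator: "U \<in> generators F \<Longrightarrow> lsubspace U"
  by (simp add: generators_iff ti_def)

lemma ex_generator: "\<exists>U. U \<in> generators F"
proof -
  have "d \<in> ldim ` ti_subspaces F"
    unfolding witt_index_def using ti_zero ti_iff by (intro Max_in) auto
  thus ?thesis by (auto simp: generators_def)
qed

text \<open>Otherwise adjoining \<open>w\<close> would give a totally isotropic subspace of
  dimension \<open>d + 1\<close>.\<close>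

lemma generator_maximal:
  assumes U: "U \<in> generators F" and w: "w \<in> S" "\<And>u. u \<in> U \<Longrightarrow> B u w = 0"
  shows "w \<in> U"
proof (rule ccontr)
  assume "w \<notin> U"
  hence "card (lext U w) = q ^ Suc d"
    using U by (simp add: card_lext' lsubspace_generator card_generator)
  moreover have "ti (lext U w)" using U w by (intro ti_lext ti_generator) auto
  ultimately have "ldim (lext U w) = Suc d" "ldim (lext U w) \<le> d"
    by (auto simp: ti_def intro!: ldim_eqI' ldim_ti_le)
  thus False by simp
qed

text \<open>By maximality \<open>w\<close> is not perpendicular to all of \<open>U\<close>, so it
  cuts out a hyperplane of \<open>U\<close>.\<close>

lemma card_generator_perp:
  assumes U: "U \<in> generators F" and w: "w \<in> S" "w \<notin> U"
  shows "q ^ d = q * card {u \<in> U. B u w = 0}"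
proof -
  obtain v where "v \<in> U" "B v w \<noteq> 0" using generator_maximal assms by blast
  with card_perp[of U v w] show ?thesis using U by (simp add: lsubspace_generator card_generator)
qed

section \<open>Distances in the dual polar graph\<close>

lemma dual_polar_adj_iff:
  assumes "U \<in> generators F" "W \<in> generators F" "d \<ge> 1"
  shows "dual_polar_adj F U W \<longleftrightarrow> q * card (U \<inter> W) = q ^ d"
proof -
  have sub: "lsubspace (U \<inter> W)" using assms by (auto intro: fs.subspace_inter lsubspace_generator)
  \<comment> \<open>\<open>d \<ge> 1\<close> makes the truncated \<open>d - 1\<close> a true
    predecessor.\<close>
  have "q * card (U \<inter> W) = q ^ d \<longleftrightarrow> card (U \<inter> W) = q ^ (d - 1)"
    using assms(3) q_gt_1 by (cases d) auto
  also have "\<dots> \<longleftrightarrow> ldim (U \<inter> W) = d - 1"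
    using card_lsubspace'[OF sub] ldim_eqI'[OF sub] by metis
  finally show ?thesis using assms by (simp add: dual_polar_adj_def)
qed

text \<open>One edge costs at most a factor q: \<open>U \<inter> V\<close> has index q in
  \<open>V\<close>, so inside \<open>V\<close> it contains at least a q-th part of
  \<open>V \<inter> W\<close>.\<close>

lemma walk_lower:
  assumes "walk (generators F) (dual_polar_adj F) k U W" "d \<ge> 1" "W \<in> generators F"
  shows "q ^ d \<le> q ^ k * card (U \<inter> W)"
  using assms
proof (induction)
  case (walk0 U)
  thus ?case by (simp add: card_generator)
next
  case (walkS U V k W)
  have V: "V \<in> generators F" using walkS.hyps by (simp add: dual_polar_adj_def)
  have sub: "lsubspace U" "lsubspace V" "lsubspace W"
    using walkS V by (auto intro: lsubspace_generator)
  have adj: "q * card (U \<inter> V) = q ^ d"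
    using dual_polar_adj_iff walkS V by blast
  have "card (U \<inter> V) * card (V \<inter> W) \<le> card ((U \<inter> V) \<inter> (V \<inter> W)) * card V"
    using sub by (intro card_Int_subspaces fs.subspace_inter) auto
  also have "\<dots> \<le> card (U \<inter> W) * card V"
    by (intro mult_right_mono card_mono) auto
  finally have "q * (card (U \<inter> V) * card (V \<inter> W)) \<le> q * (card (U \<inter> W) * card V)"
    by (rule mult_left_mono) simp
  moreover have "q * (card (U \<inter> V) * card (V \<inter> W)) = q ^ d * card (V \<inter> W)"
    by (simp only: adj[symmetric] ac_simps)
  moreover have "q * (card (U \<inter> W) * card V) = q ^ d * (q * card (U \<inter> W))"
    by (simp only: card_generator[OF V] ac_simps)
  ultimately have "q ^ d * card (V \<inter> W) \<le> q ^ d * (q * card (U \<inter> W))" by (simp only:)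
  hence "card (V \<inter> W) \<le> q * card (U \<inter> W)" using q_gt_1 by simp
  hence "q ^ k * card (V \<inter> W) \<le> q ^ k * (q * card (U \<inter> W))" by (rule mult_left_mono) simp
  moreover have "q ^ d \<le> q ^ k * card (V \<inter> W)" using walkS by blast
  ultimately show ?case by (simp only: power_Suc ac_simps)
qed

text \<open>Take \<open>w\<close> in \<open>W\<close> outside \<open>U\<close>, and let
  \<open>V\<close> be spanned by \<open>w\<close> and the hyperplane of \<open>U\<close>
  perpendicular to \<open>w\<close>. That hyperplane contains \<open>U \<inter> W\<close> because
  \<open>W\<close> is totally isotropic, so one edge gains the new vector \<open>w\<close> of
  \<open>W\<close> and loses nothing of \<open>W\<close>.\<close>

lemma exchange:
  assumes U: "U \<in> generators F" and W: "W \<in> generators F" and ne: "U \<noteq> W" and d: "d \<ge> 1"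
  obtains V where "V \<in> generators F" "dual_polar_adj F U V" "card (V \<inter> W) \<ge> q * card (U \<inter> W)"
proof -
  have "\<not> W \<subseteq> U"
    using card_subset_eq[of U W] ne card_generator[OF U] card_generator[OF W] by (metis finite)
  then obtain w where w: "w \<in> W" "w \<notin> U" by blast
  have wS: "w \<in> S" using w W by (auto simp: generators_iff ti_def)
  let ?H = "{u \<in> U. B u w = 0}"
  have H: "lsubspace ?H" using U by (intro lsubspace_perp lsubspace_generator)
  have cH: "q ^ d = q * card ?H" using card_generator_perp[OF U wS w(2)] .
  define V where "V = lext ?H w"
  have V: "V \<in> generators F"
    unfolding generators_iff V_def
  proof
    show "ti (lext ?H w)" using wS H U by (intro ti_lext ti_subset[OF ti_generator[OF U]]) auto
    show "card (lext ?H w) = q ^ d" using w cH by (subst card_lext'[OF H]) auto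
  qed
  have sub: "lsubspace U" "lsubspace W" using U W by (auto intro: lsubspace_generator)
  have "U \<inter> V = ?H"
  proof
    show "U \<inter> V \<subseteq> ?H"
    proof
      fix x assume x: "x \<in> U \<inter> V"
      then obtain c u where u: "u \<in> ?H" "x = u + fscale c w" by (auto simp: V_def mem_lext)
      have "fscale c w \<in> U" using fs.subspace_diff[OF sub(1), of x u] x u by simp
      hence "fscale (1 / c) (fscale c w) \<in> U" by (rule fs.subspace_scale[OF sub(1)])
      hence "c = 0" using w by (cases "c = 0") auto
      thus "x \<in> ?H" using u by simp
    qed
    show "?H \<subseteq> U \<inter> V" unfolding V_def using subset_lext[of ?H w] by blast
  qed
  hence "dual_polar_adj F U V" using dual_polar_adj_iff[OF U V d] cH by simp
  moreover have "lext (U \<inter> W) w \<subseteq> V \<inter> W"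
  proof (rule lext_minimal)
    have "U \<inter> W \<subseteq> ?H" using W w by (auto simp: generators_iff ti_def)
    thus "U \<inter> W \<subseteq> V \<inter> W" unfolding V_def using subset_lext[of ?H w] by blast
    show "w \<in> V \<inter> W" using w mem_lext_self[OF H] by (simp add: V_def)
    show "lsubspace (V \<inter> W)" using sub lsubspace_generator[OF V] by (intro fs.subspace_inter)
  qed
  hence "card (lext (U \<inter> W) w) \<le> card (V \<inter> W)" by (intro card_mono) auto
  hence "q * card (U \<inter> W) \<le> card (V \<inter> W)"
    using sub w by (subst (asm) card_lext') (auto intro: fs.subspace_inter)
  ultimately show ?thesis using that V by blast
qed

lemma ex_walk:
  assumes "U \<in> generators F" "W \<in> generators F" "d \<ge> 1" "q ^ d \<le> q ^ k * card (U \<inter> W)"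
  shows "\<exists>j\<le>k. walk (generators F) (dual_polar_adj F) j U W"
  using assms
proof (induction k arbitrary: U)
  case 0
  \<comment> \<open>For k = 0 the intersection has the full size q^d.\<close>
  have "U \<inter> W = U" using 0 by (intro card_seteq) (auto simp: card_generator)
  moreover have "U \<inter> W = W" using 0 by (intro card_seteq) (auto simp: card_generator)
  ultimately have "U = W" by simp
  thus ?case using 0 by (auto intro: walk0)
next
  case (Suc k)
  show ?case
  proof (cases "U = W")
    case True
    thus ?thesis using Suc.prems by (intro exI[of _ 0]) (auto intro: walk0)
  next
    case False
    then obtain V where V: "V \<in> generators F" "dual_polar_adj F U V" 
        "card (V \<inter> W) \<ge> q * card (U \<inter> W)"
      using exchange Suc.prems by blast
    have "q ^ d \<le> q ^ k * (q * card (U \<inter> W))"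
      using Suc.prems(4) by (simp only: power_Suc ac_simps)
    also have "\<dots> \<le> q ^ k * card (V \<inter> W)"
      using V(3) by (rule mult_left_mono) simp
    finally have "q ^ d \<le> q ^ k * card (V \<inter> W)" .
    then obtain j where "j \<le> k" "walk (generators F) (dual_polar_adj F) j V W"
      using Suc.IH[OF V(1)] Suc.prems by blast
    thus ?thesis using V Suc.prems(1) by (intro exI[of _ "Suc j"]) (auto intro: walkS)
  qed
qed

text \<open>Distance is d - dim (U \<inter> W), in multiplicative form. The walk built by exchanges
  also ensures that the \<open>LEAST\<close> in \<open>gdist\<close> is attained.\<close>

lemma card_Int_generators:
  assumes "U \<in> generators F" "W \<in> generators F" "d \<ge> 1"
  shows "q ^ gdist (generators F) (dual_polar_adj F) U W * card (U \<inter> W) = q ^ d"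
proof -
  let ?walk = "\<lambda>k. walk (generators F) (dual_polar_adj F) k U W"
  let ?m = "ldim (U \<inter> W)"
  have sub: "lsubspace (U \<inter> W)" using assms by (auto intro: fs.subspace_inter lsubspace_generator)
  have m: "card (U \<inter> W) = q ^ ?m" by (rule card_lsubspace'[OF sub])
  have "q ^ ?m \<le> q ^ d"
    unfolding m[symmetric] card_generator[OF assms(1), symmetric] by (intro card_mono) auto
  hence md: "?m \<le> d" using q_gt_1 by simp
  have dd: "q ^ d = q ^ (d - ?m) * card (U \<inter> W)"
    unfolding m power_add[symmetric] using md by simp
  then obtain j where j: "j \<le> d - ?m" "?walk j"
    using ex_walk[OF assms, of "d - ?m"] by auto
  have lower: "d - ?m \<le> k" if "?walk k" for k
  proof -
    have "q ^ d \<le> q ^ (k + ?m)" 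
      using walk_lower[OF that assms(3,2)] unfolding m power_add .
    thus ?thesis using q_gt_1 by simp
  qed
  have "gdist (generators F) (dual_polar_adj F) U W = d - ?m"
    unfolding gdist_def using j lower[OF j(2)] by (intro Least_equality lower) auto
  thus ?thesis using dd by (simp only:)
qed

end

lemma sum_card_swap:
  assumes "finite A" "finite B"
  shows "(\<Sum>a\<in>A. card {b \<in> B. R a b}) = (\<Sum>b\<in>B. card {a \<in> A. R a b})"
  unfolding card_eq_sum by (rule sum.swap_restrict[OF assms])

context polar_space
begin

section \<open>Counting isotropic vectors\<close>

lemma card_vectors: "card (UNIV :: ('n \<Rightarrow> 'a) set) = q ^ n"
  using q_gt_1 zero_less_card_finite[where ?'a='n] by (simp add: card_fun CARD_a CARD_n)

text \<open>Nondegeneracy is available for isotropic vectors only: in even characteristic the polar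
  form of a parabolic quadric has a nonzero radical, spanned by a vector off the quadric.\<close>

lemma card_perp_vector:
  assumes "x \<in> S" "x \<noteq> 0"
  shows "q * card {w. B w x = 0} = q ^ n"
proof -
  obtain v where "B v x \<noteq> 0" using S_nondegenerate assms by blast
  with card_perp[of UNIV v x] show ?thesis by (simp add: card_vectors)
qed

text \<open>Count perpendicular pairs between \<open>U\<close> and the whole space twice. A vector
  \<open>v\<close> sees all of \<open>U\<close> or a hyperplane of it; a vector \<open>u\<close> of
  \<open>U\<close> sees everything if it is zero and a hyperplane otherwise. The factor q on both
  sides avoids division.\<close>

lemma card_ti_perp:
  assumes U: "ti U"
  shows "card {v. \<forall>u\<in>U. B v u = 0} * card U = q ^ n"
proof -
  let ?P = "{v. \<forall>u\<in>U. B v u = 0}"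
  have sub: "lsubspace U" and U0: "0 \<in> U" using U by (auto simp: ti_def fs.subspace_0)
  have "(\<Sum>v\<in>UNIV. q * card {u \<in> U. B u v = 0}) = (\<Sum>u\<in>U. q * card {v \<in> UNIV. B u v = 0})"
    unfolding sum_distrib_left[symmetric] using sum_card_swap[of UNIV U "\<lambda>v u. B u v = 0"] by simp
  also have "(\<Sum>v\<in>UNIV. q * card {u \<in> U. B u v = 0})
      = (\<Sum>v\<in>UNIV. card U + (if v \<in> ?P then (q - 1) * card U else 0))"
  proof (rule sum.cong)
    fix v
    show "q * card {u \<in> U. B u v = 0} = card U + (if v \<in> ?P then (q - 1) * card U else 0)"
    proof (cases "v \<in> ?P")
      case True
      hence "{u \<in> U. B u v = 0} = U" using B_sym by auto
      thus ?thesis using True q_gt_1 by (cases q) auto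
    next
      case False
      then obtain u where "u \<in> U" "B u v \<noteq> 0" using B_sym by auto
      with card_perp[OF sub this] show ?thesis unfolding if_not_P[OF False] by simp
    qed
  qed simp
  also have "\<dots> = q ^ n * card U + card ?P * ((q - 1) * card U)"
    by (simp add: sum.distrib sum.If_cases card_vectors)
  also have "(\<Sum>u\<in>U. q * card {v \<in> UNIV. B u v = 0})
      = (\<Sum>u\<in>U. q ^ n + (if u = 0 then (q - 1) * q ^ n else 0))"
  proof (rule sum.cong)
    fix u assume "u \<in> U"
    hence "u \<in> S" using U by (auto simp: ti_def)
    thus "q * card {v \<in> UNIV. B u v = 0} = q ^ n + (if u = 0 then (q - 1) * q ^ n else 0)"
      using card_perp_vector[of u] B_sym_iff[of u] q_gt_1
      by (cases q) (auto simp: card_vectors)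
  qed simp
  also have "\<dots> = q ^ n * card U + (q - 1) * q ^ n"
    using U0 by (simp add: sum.distrib)
  finally have "(q - 1) * (card ?P * card U) = (q - 1) * q ^ n"
    by (simp add: ac_simps)
  thus ?thesis using q_gt_1 by simp
qed

text \<open>Count pairs \<open>(w, a)\<close> with \<open>w \<in> D\<close> and \<open>w + a x \<in> S\<close> in two ways.\<close>
lemma card_translation_invariant:
  assumes x: "x \<in> S" and inv: "\<And>w a. w \<in> D \<Longrightarrow> w + fscale a x \<in> D"
    and D: "\<And>w. w \<in> D \<Longrightarrow> B w x \<noteq> 0"
  shows "q * card (S \<inter> D) = \<tau> * card D"
proof -
  have "card D * \<tau> = (\<Sum>w\<in>D. card {a \<in> UNIV. w + fscale a x \<in> S})"
    using card_S_line[OF x D] by simp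
  also have "\<dots> = (\<Sum>a\<in>UNIV. card {w \<in> D. w + fscale a x \<in> S})"
    by (rule sum_card_swap) auto
  also have "\<dots> = (\<Sum>a\<in>(UNIV :: 'a set). card (S \<inter> D))"
  proof (rule sum.cong)
    fix a :: 'a
    have "bij_betw (\<lambda>w. w + fscale a x) {w \<in> D. w + fscale a x \<in> S} (S \<inter> D)"
      by (rule bij_betwI[where g="\<lambda>w. w + fscale (- a) x"])
        (use inv[of _ "- a"] in \<open>auto simp: inv\<close>)
    thus "card {w \<in> D. w + fscale a x \<in> S} = card (S \<inter> D)" by (rule bij_betw_same_card)
  qed simp
  finally show ?thesis by (simp add: CARD_a ac_simps)
qed

text \<open>With \<open>\<tau>\<close> = q^\<delta> and e = n - 2d + \<delta> this is q^(d+e-2),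
  while \<open>A\<close> is q^(d-1). It need not be an integer: d = 1 and e = 0 give 1/q.\<close>

definition T :: real where "T = real \<tau> * real q ^ n / (real q ^ 2 * real q ^ d)"
definition A :: real where "A = real q ^ d / real q"

lemma T_nonneg: "T \<ge> 0"
  by (simp add: T_def)

lemma A_pos: "A > 0"
  using q_gt_1 by (simp add: A_def)

lemma q_mult_A: "real q * A = real q ^ d"
  using q_gt_1 by (simp add: A_def)

lemma card_generator_nonperp:
  assumes U: "U \<in> generators F" and w: "w \<in> S" "w \<notin> U"
  shows "real (card {u \<in> U. B w u \<noteq> 0}) = (real q - 1) * A"
proof -
  have "card {u \<in> U. B w u \<noteq> 0} + card {u \<in> U. B u w = 0} = card U"
    by (subst card_Un_disjoint[symmetric]) (auto intro!: arg_cong[where f=card] dest: B_sym)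
  moreover have "real (card {u \<in> U. B u w = 0}) = A"
    using arg_cong[OF card_generator_perp[OF U w], of real] q_gt_1 by (simp add: A_def)
  moreover have "real (card U) = real q * A" using card_generator[OF U] by (simp add: q_mult_A)
  ultimately have "real (card {u \<in> U. B w u \<noteq> 0}) + A = real q * A" by linarith
  thus ?thesis by (simp add: algebra_simps)
qed

lemma card_generator_perp_self:
  assumes U: "U \<in> generators F" and w: "w \<in> U"
  shows "{u \<in> U. B w u \<noteq> 0} = {}"
  using ti_generator[OF U] w by (auto simp: ti_def)

lemma A_mult_T: "A * T = real \<tau> * real q ^ n / real q ^ 3"
  using q_gt_1 by (simp add: A_def T_def field_simps power3_eq_cube power2_eq_square)

text \<open>As \<open>x\<close> is isotropic, translation by its multiples preserves the complement
  of the hyperplane perpendicular to \<open>x\<close>; hence a share \<tau>/q of that complement is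
  isotropic.\<close>

lemma card_noncollinear:
  assumes x: "x \<in> S" "x \<noteq> 0"
  shows "real (card {w \<in> S. B w x \<noteq> 0}) = (real q - 1) * (real q * A * T)"
proof -
  let ?D = "{w. B w x \<noteq> 0}"
  have "q * card (S \<inter> ?D) = \<tau> * card ?D"
    using x by (intro card_translation_invariant[of x]) (auto simp: B_add B_scale S_self)
  hence 1: "real q * real (card (S \<inter> ?D)) = real \<tau> * real (card ?D)"
    by (simp only: of_nat_mult[symmetric])
  have "card ?D + card {w. B w x = 0} = q ^ n"
    unfolding card_vectors[symmetric]
    by (subst card_Un_disjoint[symmetric]) (auto intro!: arg_cong[where f=card])
  hence "real (card ?D) = real q ^ n - real (card {w. B w x = 0})"
    unfolding of_nat_power[symmetric] by linarith
  moreover have "real q * real (card {w. B w x = 0}) = real q ^ n"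
    using card_perp_vector[OF x] by (metis of_nat_mult of_nat_power)
  ultimately have 2: "real q * real (card ?D) = real q * real q ^ n - real q ^ n"
    by (simp only: right_diff_distrib)
  have "real q ^ 2 * real (card (S \<inter> ?D)) = real q * (real q * real (card (S \<inter> ?D)))"
    by (simp add: power2_eq_square)
  also have "\<dots> = real \<tau> * (real q * real (card ?D))"
    unfolding 1 by (simp only: ac_simps)
  finally have "real q ^ 2 * real (card (S \<inter> ?D)) = real \<tau> * (real q * real q ^ n - real q ^ n)"
    unfolding 2 .
  hence "real (card (S \<inter> ?D)) = (real q - 1) * (real q * A * T)"
    using q_gt_1 by (simp add: A_mult_T mult.assoc field_simps power2_eq_square power3_eq_cube)
  thus ?thesis by (simp add: Int_def)
qed

text \<open>Fix a generator \<open>U\<close> and count non-perpendicular pairs between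
  \<open>U\<close> and \<open>S\<close> twice: a nonzero \<open>u\<close> has (q-1)qAT partners, and
  a \<open>w\<close> outside \<open>U\<close> has (q-1)A.\<close>

lemma card_isotropic:
  assumes d: "d \<ge> 1"
  shows "real (card S) = (real q * A - 1) * (real q * T + 1) + 1"
proof -
  obtain U where U: "U \<in> generators F" using ex_generator by blast
  have sub: "lsubspace U" and US: "U \<subseteq> S" using ti_generator[OF U] by (auto simp: ti_def)
  have U0: "0 \<in> U" using sub by (rule fs.subspace_0)
  have cU: "real (card U) = real q * A" using card_generator[OF U] by (simp add: q_mult_A)
  have "(\<Sum>u\<in>U. card {w \<in> S. B w u \<noteq> 0}) = (\<Sum>w\<in>S. card {u \<in> U. B w u \<noteq> 0})"
    by (rule sum_card_swap) auto
  hence "(\<Sum>u\<in>U. real (card {w \<in> S. B w u \<noteq> 0})) = (\<Sum>w\<in>S. real (card {u \<in> U. B w u \<noteq> 0}))"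
    by (simp flip: of_nat_sum)
  also have "(\<Sum>u\<in>U. real (card {w \<in> S. B w u \<noteq> 0}))
      = (\<Sum>u\<in>U. if u = 0 then 0 else (real q - 1) * (real q * A * T))"
    using US by (intro sum.cong) (auto simp: card_noncollinear)
  also have "\<dots> = (\<Sum>u\<in>U. (real q - 1) * (real q * A * T))
      - (\<Sum>u\<in>U. if u = 0 then (real q - 1) * (real q * A * T) else 0)"
    unfolding sum_subtractf[symmetric] by (intro sum.cong) auto
  also have "\<dots> = (real q * A - 1) * ((real q - 1) * (real q * A * T))"
    using U0 by (simp add: cU algebra_simps)
  also have "(\<Sum>w\<in>S. real (card {u \<in> U. B w u \<noteq> 0}))
      = (\<Sum>w\<in>S. if w \<in> U then 0 else (real q - 1) * A)"
  proof (rule sum.cong)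
    fix w assume w: "w \<in> S"
    show "real (card {u \<in> U. B w u \<noteq> 0}) = (if w \<in> U then 0 else (real q - 1) * A)"
      using card_generator_nonperp[OF U w] card_generator_perp_self[OF U] by (cases "w \<in> U") auto
  qed simp
  also have "\<dots> = (real (card S) - real q * A) * ((real q - 1) * A)"
  proof -
    have "S \<inter> - U = S - U" by auto
    thus ?thesis using US card_mono[OF _ US] 
      by (simp add: sum.If_cases card_Diff_subset of_nat_diff cU)
  qed
  finally have "((real q - 1) * A) * ((real q * A - 1) * (real q * T))
      = ((real q - 1) * A) * (real (card S) - real q * A)" by (simp add: ac_simps)
  hence "(real q * A - 1) * (real q * T) = real (card S) - real q * A"
    using q_gt_1 A_pos by simp
  thus ?thesis by (simp add: algebra_simps)
qed

end

section \<open>Bounding a dimension by squared norms\<close>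

text \<open>The gap between the two sides is the squared norm of \<open>p\<close> minus its
  projection \<open>?s\<close> onto the span of \<open>E\<close>.\<close>

lemma finite_Bessel:
  fixes p :: "'b::real_inner"
  assumes fin: "finite E" and orth: "pairwise orthogonal E" and unit: "\<And>e. e \<in> E \<Longrightarrow> norm e = 1"
  shows "(\<Sum>e\<in>E. (p \<bullet> e)\<^sup>2) \<le> p \<bullet> p"
proof -
  let ?s = "\<Sum>e\<in>E. (p \<bullet> e) *\<^sub>R e"
  have se: "?s \<bullet> e = p \<bullet> e" if e: "e \<in> E" for e
  proof -
    have "?s \<bullet> e = (\<Sum>f\<in>E. if f = e then p \<bullet> e else 0)"
      unfolding inner_sum_left
    proof (intro sum.cong refl)
      fix f assume f: "f \<in> E"
      show "((p \<bullet> f) *\<^sub>R f) \<bullet> e = (if f = e then p \<bullet> e else 0)"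
        using orth unit[OF e] f e by (auto simp: pairwise_def orthogonal_def norm_eq_1)
    qed
    thus ?thesis using fin e by simp
  qed
  have xs: "x \<bullet> ?s = (\<Sum>e\<in>E. (p \<bullet> e) * (x \<bullet> e))" for x
    by (simp add: inner_sum_right)
  have ps: "p \<bullet> ?s = (\<Sum>e\<in>E. (p \<bullet> e)\<^sup>2)"
    by (simp add: xs power2_eq_square)
  have ss: "?s \<bullet> ?s = (\<Sum>e\<in>E. (p \<bullet> e)\<^sup>2)"
    unfolding xs[of ?s] by (intro sum.cong refl) (simp only: se power2_eq_square)
  have "0 \<le> (p - ?s) \<bullet> (p - ?s)" by simp
  also have "\<dots> = p \<bullet> p - (\<Sum>e\<in>E. (p \<bullet> e)\<^sup>2)"
    by (simp add: inner_diff_left inner_diff_right inner_commute[of ?s p] ps ss)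
  finally show ?thesis by simp
qed

text \<open>A subspace on which the coordinates are represented by vectors \<open>p x\<close> (as by the
  columns of a projection onto it) has dimension at most the sum of their squared norms: expand in an
  orthonormal basis.\<close>
lemma card_independent_le_sum_norms:
  fixes p :: "'i::finite \<Rightarrow> real ^ 'i"
  assumes ind: "independent R" and rep: "\<And>x r. r \<in> R \<Longrightarrow> p x \<bullet> r = r $ x"
  shows "real (card R) \<le> (\<Sum>x\<in>UNIV. p x \<bullet> p x)"
proof -
  obtain E where E: "E \<subseteq> span R" "pairwise orthogonal E" "\<And>e. e \<in> E \<Longrightarrow> norm e = 1"
      "independent E" "card E = dim (span R)"
    using orthonormal_basis_subspace[OF subspace_span[of R]] by metis
  have fin: "finite E" using E(4) by (rule independent_imp_finite)
  \<comment> \<open>The condition is linear in \<open>r\<close>, so it passes from \<open>R\<close>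
    to its span and to the orthonormal basis.\<close>
  have rep': "p x \<bullet> e = e $ x" if "e \<in> E" for x e
  proof -
    have "subspace {e. p x \<bullet> e = e $ x}"
      by (rule subspaceI) (auto simp: inner_add_right)
    hence "span R \<subseteq> {e. p x \<bullet> e = e $ x}" using rep by (intro span_minimal) auto
    thus ?thesis using that E(1) by blast
  qed
  have "real (card R) = (\<Sum>e\<in>E. e \<bullet> e)"
    using E(3,5) dim_eq_card_independent[OF ind] by (simp add: norm_eq_1)
  also have "\<dots> = (\<Sum>e\<in>E. \<Sum>x\<in>UNIV. (p x \<bullet> e)\<^sup>2)"
  proof (intro sum.cong refl)
    fix e assume "e \<in> E"
    hence "(\<Sum>x\<in>UNIV. (p x \<bullet> e)\<^sup>2) = (\<Sum>x\<in>UNIV. (e $ x)\<^sup>2)" by (simp only: rep')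
    thus "e \<bullet> e = (\<Sum>x\<in>UNIV. (p x \<bullet> e)\<^sup>2)"
      by (simp only: inner_vec_def[of e e] power2_eq_square inner_real_def)
  qed
  also have "\<dots> = (\<Sum>x\<in>UNIV. \<Sum>e\<in>E. (p x \<bullet> e)\<^sup>2)"
    by (rule sum.swap)
  also have "\<dots> \<le> (\<Sum>x\<in>UNIV. p x \<bullet> p x)"
    by (intro sum_mono finite_Bessel fin E)
  finally show ?thesis .
qed

context polar_space
begin

section \<open>Rows of the incidence matrix\<close>

text \<open>The rows are indexed by all vectors instead of points; every point is represented by its
  \<open>q - 1\<close> nonzero vectors.\<close>
definition row :: "('n \<Rightarrow> 'a) set \<Rightarrow> real ^ ('n \<Rightarrow> 'a)" where
  "row U = (\<chi> v. if v \<in> U \<and> v \<noteq> 0 then 1 else 0)"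

lemma row_nth: "row U $ v = (if v \<in> U \<and> v \<noteq> 0 then 1 else 0)"
  by (simp add: row_def)

lemma inner_row: "x \<bullet> row U = (\<Sum>v\<in>U - {0}. x $ v)"
  unfolding inner_vec_def by (rule sum.mono_neutral_cong_right) (auto simp: row_nth)

lemma inner_row_row:
  assumes "lsubspace U" "lsubspace W"
  shows "row U \<bullet> row W = real (card (U \<inter> W)) - 1"
proof -
  have 0: "0 \<in> U \<inter> W" using assms by (auto intro: fs.subspace_0)
  have "row U \<bullet> row W = (\<Sum>v\<in>(U \<inter> W) - {0}. 1)"
    unfolding inner_row by (rule sum.mono_neutral_cong_right) (auto simp: row_nth)
  also have "\<dots> = real (card ((U \<inter> W) - {0}))" by simp
  also have "\<dots> = real (card (U \<inter> W)) - 1"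
    using card_Suc_Diff1[OF finite 0] by linarith
  finally show ?thesis .
qed

lemma row_inject:
  assumes "U \<in> generators F" "W \<in> generators F" "row U = row W"
  shows "U = W"
proof -
  have "v \<in> U \<longleftrightarrow> v \<in> W" for v
  proof (cases "v = 0")
    case True
    thus ?thesis using assms(1,2)[THEN lsubspace_generator, THEN fs.subspace_0] by simp
  next
    case False
    have "row U $ v = row W $ v" unfolding assms(3) ..
    with False show ?thesis unfolding row_nth by (simp split: if_splits)
  qed
  thus ?thesis by (rule set_eqI)
qed

lemma inj_on_row: "inj_on row (generators F)"
  by (rule inj_onI) (rule row_inject)

lemma resolving_if_spanning:
  assumes d: "d \<ge> 1" and sub: "S0 \<subseteq> generators F" and span: "row ` generators F \<subseteq> span (row ` S0)"
  shows "resolving_set (generators F) (dual_polar_adj F) S0"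
  unfolding resolving_set_def
proof (intro conjI sub ballI impI)
  fix U W assume U: "U \<in> generators F" and W: "W \<in> generators F" and ne: "U \<noteq> W"
  show "\<exists>x\<in>S0. gdist (generators F) (dual_polar_adj F) U x \<noteq> gdist (generators F) (dual_polar_adj F) W x"
  proof (rule ccontr)
    assume "\<not> ?thesis"
    hence eq: "gdist (generators F) (dual_polar_adj F) U x = gdist (generators F) (dual_polar_adj F) W x"
      if "x \<in> S0" for x using that by blast
    have rows: "orthogonal (row U - row W) r" if r: "r \<in> row ` S0" for r
    proof -
      obtain x where x: "x \<in> S0" "r = row x" using r by blast
      have xg: "x \<in> generators F" using x sub by blast
      \<comment> \<open>Both sizes are q^d divided by the same power of q.\<close>
      have "card (U \<inter> x) = card (W \<inter> x)"
        using trans[OF card_Int_generators[OF U xg d] card_Int_generators[OF W xg d, symmetric]] q_gt_1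
        unfolding eq[OF x(1)] by simp
      thus ?thesis
        using U W xg by (simp add: x orthogonal_def inner_diff_left inner_row_row lsubspace_generator)
    qed
    have orth: "orthogonal (row U - row W) r" if "r \<in> span (row ` S0)" for r
      by (rule orthogonal_to_span[OF that rows])
    have "row U \<in> span (row ` S0)" "row W \<in> span (row ` S0)"
      using subsetD[OF span imageI[OF U]] subsetD[OF span imageI[OF W]] .
    hence "orthogonal (row U - row W) (row U - row W)" by (rule orth[OF span_diff])
    hence "row U = row W" unfolding orthogonal_self by simp
    thus False using row_inject[OF U W] ne by simp
  qed
qed

lemma lext_zero_in_polar_points:
  assumes "v \<in> S" "v \<noteq> 0"
  shows "lext {0} v \<in> polar_points F"
proof -
  have z: "lsubspace {0 :: 'n \<Rightarrow> 'a}" using ti_zero by (simp add: ti_def)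
  have "card (lext {0} v) = q ^ 1" using assms z by (subst card_lext') auto
  moreover have "ti (lext {0} v)" using assms ti_zero by (intro ti_lext) auto
  ultimately show ?thesis
    using ldim_eqI'[of "lext {0} v" 1] by (simp add: polar_points_def ti_iff ti_def)
qed

text \<open>Passing from vectors to points loses no information: coordinates at zero or
  non-isotropic vectors vanish in every row, and any other coordinate is the incidence with the
  point spanned by the vector.\<close>

lemma rows_independent_if_independent:
  assumes ind: "independent (row ` S0)" and sub: "S0 \<subseteq> generators F"
  shows "rows_independent F S0"
  unfolding rows_independent_def
proof (intro allI impI)
  fix c :: "('n \<Rightarrow> 'a) set \<Rightarrow> real"
  assume c: "\<forall>x\<in>polar_points F. (\<Sum>U\<in>S0. c U * incidence F U x) = 0"
  have inj: "inj_on row S0" using inj_on_row sub by (rule inj_on_subset)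
  have "(\<Sum>U\<in>S0. c U *\<^sub>R row U) = 0"
  proof (rule vec_eq_iff[THEN iffD2, rule_format])
    fix v
    have "(\<Sum>U\<in>S0. c U *\<^sub>R row U) $ v = (\<Sum>U\<in>S0. c U * row U $ v)" by simp
    also have "\<dots> = 0"
    proof (cases "v \<in> S \<and> v \<noteq> 0")
      case True
      have "row U $ v = incidence F U (lext {0} v)" if "U \<in> S0" for U
      proof -
        have U: "lsubspace U" using that sub lsubspace_generator by blast
        have "v \<in> lext {0} v" using ti_zero by (intro mem_lext_self) (simp add: ti_def)
        hence "lext {0} v \<subseteq> U \<longleftrightarrow> v \<in> U"
          using lext_minimal[OF U, of "{0}" v] fs.subspace_0[OF U] by blast
        thus ?thesis using True by (simp add: row_nth incidence_def)
      qed
      thus ?thesis using c lext_zero_in_polar_points True by simp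
    next
      case False
      have "row U $ v = 0" if "U \<in> S0" for U
        using that sub False ti_generator by (auto simp: row_nth ti_def)
      thus ?thesis by simp
    qed
    finally show "(\<Sum>U\<in>S0. c U *\<^sub>R row U) $ v = 0 $ v" by simp
  qed
  hence "(\<Sum>r\<in>row ` S0. c (the_inv_into S0 row r) *\<^sub>R r) = 0"
    by (simp add: sum.reindex[OF inj] the_inv_into_f_f[OF inj])
  hence "\<forall>r\<in>row ` S0. c (the_inv_into S0 row r) = 0"
    by (intro ballI independentD[OF ind, of "row ` S0"]) auto
  thus "\<forall>U\<in>S0. c U = 0" by (simp add: the_inv_into_f_f[OF inj])
qed

section \<open>Bounding the rank\<close>

text \<open>Chosen so that \<open>proj x\<close> is orthogonal to the row of a generator missing
  \<open>x\<close>: its (q-1)A vectors not perpendicular to \<open>x\<close> are balanced by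
  \<open>c0\<close> on its qA - 1 nonzero vectors.\<close>

definition c0 :: real where "c0 = A * (real q - 1) / (real q * A - 1)"

text \<open>Up to the multiplicities \<open>q - 1\<close>, these are the columns of the projection onto the sum of
  the eigenspaces of the collinearity graph that contain the rows.\<close>
definition proj :: "('n \<Rightarrow> 'a) \<Rightarrow> real ^ ('n \<Rightarrow> 'a)" where
  "proj x = (\<chi> y. if x \<in> S - {0} \<and> y \<in> S - {0}
     then (T * of_bool (y \<in> lext {0} x) - of_bool (B x y \<noteq> 0) + c0) / ((real q - 1) * (T + A)) else 0)"

lemma q_mult_A_gt_1:
  assumes "d \<ge> 1"
  shows "real q * A > 1"
  unfolding q_mult_A using assms q_gt_1 by (intro one_less_power) auto

lemma card_lext_zero:
  fixes x :: "'n \<Rightarrow> 'a"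
  assumes "x \<noteq> 0"
  shows "real (card (lext {0} x - {0})) = real q - 1"
proof -
  have z: "lsubspace {0 :: 'n \<Rightarrow> 'a}" using ti_zero by (simp add: ti_def)
  have "card (lext {0} x) = q" using assms z by (subst card_lext') auto
  moreover have "0 \<in> lext {0} x" using z by (intro fs.subspace_0 lsubspace_lext)
  ultimately show ?thesis using q_gt_1 by (simp add: of_nat_diff)
qed

lemma lext_zero_subset_iff:
  assumes "lsubspace U" "y \<in> lext {0} x" "y \<noteq> 0"
  shows "y \<in> U \<longleftrightarrow> x \<in> U"
proof -
  obtain c where c: "y = fscale c x" using assms by (auto simp: mem_lext)
  with assms(3) have "c \<noteq> 0" by auto
  hence "x = fscale (1 / c) y" using c by simp
  thus ?thesis using fs.subspace_scale[OF assms(1), of x c]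
      fs.subspace_scale[OF assms(1), of y "1 / c"] unfolding c[symmetric] by auto
qed

lemma proj_row:
  assumes d: "d \<ge> 1" and U: "U \<in> generators F"
  shows "proj x \<bullet> row U = row U $ x"
proof (cases "x \<in> S - {0}")
  case False
  thus ?thesis using ti_generator[OF U] by (auto simp: inner_row proj_def row_nth ti_def)
next
  case True
  have U0: "0 \<in> U" and US: "U \<subseteq> S" and sub: "lsubspace U"
    using ti_generator[OF U] by (auto simp: ti_def fs.subspace_0)
  have cU: "real (card (U - {0})) = real q * A - 1"
    using U0 card_generator[OF U] q_gt_1 by (simp add: q_mult_A of_nat_diff)
  \<comment> \<open>The value before normalisation when \<open>x \<in> U\<close>: (q-1)T from the
    multiples of \<open>x\<close>, (q-1)A from the constant.\<close>
  let ?\<beta> = "(real q - 1) * (T + A)"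
  have \<beta>: "?\<beta> \<noteq> 0" using q_gt_1 A_pos T_nonneg by simp
  have "proj x \<bullet> row U = (\<Sum>y\<in>U - {0}. (T * of_bool (y \<in> lext {0} x) - of_bool (B x y \<noteq> 0) + c0) / ?\<beta>)"
    unfolding inner_row using True US by (intro sum.cong) (auto simp: proj_def)
  also have "\<dots> = (T * (\<Sum>y\<in>U - {0}. of_bool (y \<in> lext {0} x))
      - (\<Sum>y\<in>U - {0}. of_bool (B x y \<noteq> 0)) + real (card (U - {0})) * c0) / ?\<beta>"
    by (simp add: sum_divide_distrib[symmetric] sum.distrib sum_subtractf sum_distrib_left)
  also have "(\<Sum>y\<in>U - {0}. of_bool (y \<in> lext {0} x)) = (if x \<in> U then real q - 1 else 0)"
  proof -
    have "(U - {0}) \<inter> {y. y \<in> lext {0} x} = (if x \<in> U then lext {0} x - {0} else {})"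
      using lext_zero_subset_iff[OF sub, of _ x] by auto
    thus ?thesis using True by (simp add: sum_of_bool_eq card_lext_zero)
  qed
  also have "(\<Sum>y\<in>U - {0}. of_bool (B x y \<noteq> 0)) = (if x \<in> U then 0 else (real q - 1) * A)"
  proof -
    have "(U - {0}) \<inter> {y. B x y \<noteq> 0} = {y \<in> U. B x y \<noteq> 0}" by auto
    thus ?thesis using card_generator_nonperp[OF U, of x] card_generator_perp_self[OF U, of x] True
      by (auto simp: sum_of_bool_eq)
  qed
  also have "real (card (U - {0})) * c0 = (real q - 1) * A"
    using q_mult_A_gt_1[OF d] by (simp add: cU c0_def)
  finally show ?thesis using \<beta> True by (auto simp: row_nth algebra_simps)
qed

text \<open>For an orthogonal projection the squared norm of a column is its diagonal entry, here
  the coefficient at \<open>y = x\<close>. This is confirmed by expanding over the multiples of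
  \<open>x\<close>, the vectors not perpendicular to \<open>x\<close>, and the rest.\<close>

lemma inner_proj:
  assumes d: "d \<ge> 1" and x: "x \<in> S - {0}"
  shows "proj x \<bullet> proj x = (T + c0) / ((real q - 1) * (T + A))"
proof -
  let ?\<beta> = "(real q - 1) * (T + A)" and ?Q = "real q"
  have \<beta>: "?\<beta> > 0" using q_gt_1 A_pos T_nonneg by simp
  have cS: "real (card (S - {0})) = (?Q * A - 1) * (?Q * T + 1)"
    using card_isotropic[OF d] card_Suc_Diff1[OF finite S_zero] by linarith
  have c0: "c0 * (?Q * A - 1) = A * (?Q - 1)"
    using q_mult_A_gt_1[OF d] by (simp add: c0_def)
  have "proj x \<bullet> proj x
      = (\<Sum>y\<in>S - {0}. ((T * of_bool (y \<in> lext {0} x) - of_bool (B x y \<noteq> 0) + c0) / ?\<beta>)\<^sup>2)"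
    unfolding inner_vec_def using x
    by (intro sum.mono_neutral_cong_right) (auto simp: proj_def power2_eq_square)
  also have "\<dots> = (\<Sum>y\<in>S - {0}. ((T\<^sup>2 + 2 * T * c0) * of_bool (y \<in> lext {0} x)
      + (1 - 2 * c0) * of_bool (B x y \<noteq> 0) + c0\<^sup>2) / ?\<beta>\<^sup>2)"
  proof (intro sum.cong refl)
    fix y
    \<comment> \<open>Multiples of \<open>x\<close> are perpendicular to \<open>x\<close>, so the
      product of the two indicators drops out of the square.\<close>
    have "B x y = 0" if "y \<in> lext {0} x"
      using that x by (auto simp: mem_lext B_scale_right S_self)
    hence "(T * of_bool (y \<in> lext {0} x) - of_bool (B x y \<noteq> 0) + c0)\<^sup>2
      = (T\<^sup>2 + 2 * T * c0) * of_bool (y \<in> lext {0} x) + (1 - 2 * c0) * of_bool (B x y \<noteq> 0) + c0\<^sup>2"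
      by (cases "y \<in> lext {0} x"; cases "B x y = 0") (simp_all add: power2_eq_square algebra_simps)
    thus "((T * of_bool (y \<in> lext {0} x) - of_bool (B x y \<noteq> 0) + c0) / ?\<beta>)\<^sup>2
      = ((T\<^sup>2 + 2 * T * c0) * of_bool (y \<in> lext {0} x)
      + (1 - 2 * c0) * of_bool (B x y \<noteq> 0) + c0\<^sup>2) / ?\<beta>\<^sup>2"
      by (simp only: power_divide)
  qed
  also have "\<dots> = ((T\<^sup>2 + 2 * T * c0) * (\<Sum>y\<in>S - {0}. of_bool (y \<in> lext {0} x))
      + (1 - 2 * c0) * (\<Sum>y\<in>S - {0}. of_bool (B x y \<noteq> 0)) + real (card (S - {0})) * c0\<^sup>2) / ?\<beta>\<^sup>2"
    by (simp only: sum_divide_distrib[symmetric] sum.distrib sum_distrib_left[symmetric] sum_constant)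
  also have "(\<Sum>y\<in>S - {0}. of_bool (y \<in> lext {0} x)) = ?Q - 1"
  proof -
    have "(S - {0}) \<inter> {y. y \<in> lext {0} x} = lext {0} x - {0}"
      using x by (auto simp: mem_lext S_scale)
    thus ?thesis using x by (simp add: sum_of_bool_eq card_lext_zero)
  qed
  also have "(\<Sum>y\<in>S - {0}. of_bool (B x y \<noteq> 0)) = (?Q - 1) * (?Q * A * T)"
  proof -
    have "(S - {0}) \<inter> {y. B x y \<noteq> 0} = {y \<in> S. B y x \<noteq> 0}" by (auto dest: B_sym)
    thus ?thesis using card_noncollinear[of x] x by (simp add: sum_of_bool_eq)
  qed
  also have "real (card (S - {0})) * c0\<^sup>2 = (c0 * (?Q * A - 1)) * (c0 * (?Q * T + 1))"
    by (simp add: cS power2_eq_square)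
  also have "(T\<^sup>2 + 2 * T * c0) * (?Q - 1) + (1 - 2 * c0) * ((?Q - 1) * (?Q * A * T))
      + (c0 * (?Q * A - 1)) * (c0 * (?Q * T + 1)) = (T + c0) * ?\<beta>"
  proof -
    \<comment> \<open>The two sides differ by a multiple of the equation defining
      \<open>c0\<close>.\<close>
    have "(T\<^sup>2 + 2 * T * c0) * (?Q - 1) + (1 - 2 * c0) * ((?Q - 1) * (?Q * A * T))
      + (A * (?Q - 1)) * (c0 * (?Q * T + 1)) - (T + c0) * ?\<beta>
      = (?Q - 1) * T * (A * (?Q - 1) - c0 * (?Q * A - 1))"
      by (simp add: algebra_simps power2_eq_square)
    thus ?thesis unfolding c0 by simp
  qed
  finally show ?thesis using \<beta> by (simp add: power2_eq_square)
qed

lemma card_independent_rows_le: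
  assumes d: "d \<ge> 1" and sub: "S0 \<subseteq> generators F" and ind: "independent (row ` S0)"
  shows "real (card S0) \<le> (real q * T + 1) * (T * (real q * A - 1) + A * (real q - 1)) / ((real q - 1) * (T + A))"
proof -
  let ?\<beta> = "(real q - 1) * (T + A)" and ?Q = "real q"
  have cS: "real (card (S - {0})) = (?Q * A - 1) * (?Q * T + 1)"
    using card_isotropic[OF d] card_Suc_Diff1[OF finite S_zero] by linarith
  have "card S0 = card (row ` S0)"
    using inj_on_row sub by (metis card_image inj_on_subset)
  also have "real (card (row ` S0)) \<le> (\<Sum>x\<in>UNIV. proj x \<bullet> proj x)"
    using ind sub by (intro card_independent_le_sum_norms) (auto simp: proj_row[OF d])
  also have "\<dots> = (\<Sum>x\<in>S - {0}. (T + c0) / ?\<beta>)"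
  proof (rule sum.mono_neutral_cong_right)
    have "proj x = 0" if "x \<notin> S - {0}" for x using that by (auto simp: proj_def vec_eq_iff)
    thus "\<forall>x\<in>UNIV - (S - {0}). proj x \<bullet> proj x = 0" by auto
  qed (auto simp: inner_proj[OF d])
  also have "\<dots> = real (card (S - {0})) * ((T + c0) / ?\<beta>)"
    by (rule sum_constant)
  also have "\<dots> = (?Q * T + 1) * ((?Q * A - 1) * (T + c0)) / ?\<beta>"
    unfolding cS by simp
  also have "(?Q * A - 1) * (T + c0) = T * (?Q * A - 1) + A * (?Q - 1)"
    using q_mult_A_gt_1[OF d] by (simp add: c0_def distrib_left)
  finally show ?thesis .
qed

lemma metric_dimension_le:
  assumes d: "d \<ge> 1"
  shows "metric_dimension (generators F) (dual_polar_adj F) \<le> incidence_rank F"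
    and "real (metric_dimension (generators F) (dual_polar_adj F))
      \<le> (real q * T + 1) * (T * (real q * A - 1) + A * (real q - 1)) / ((real q - 1) * (T + A))"
proof -
  \<comment> \<open>A basis of the row space chosen among the rows: spanning makes it resolving,
    independence gives both bounds on its size.\<close>
  obtain R where R: "R \<subseteq> row ` generators F" "independent R" "row ` generators F \<subseteq> span R"
    using maximal_independent_subset[of "row ` generators F"] by blast
  then obtain S0 where S0: "S0 \<subseteq> generators F" "R = row ` S0" by (metis subset_imageE)
  have "resolving_set (generators F) (dual_polar_adj F) S0"
    using R S0 by (intro resolving_if_spanning[OF d]) auto
  hence 1: "metric_dimension (generators F) (dual_polar_adj F) \<le> card S0"
    unfolding metric_dimension_def by (intro Min_le) auto
  have "card S0 \<le> incidence_rank F"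
    unfolding incidence_rank_def
    using R S0 by (intro Max_ge) (auto intro!: rows_independent_if_independent)
  with 1 show "metric_dimension (generators F) (dual_polar_adj F) \<le> incidence_rank F" by simp
  show "real (metric_dimension (generators F) (dual_polar_adj F))
      \<le> (real q * T + 1) * (T * (real q * A - 1) + A * (real q - 1)) / ((real q - 1) * (T + A))"
    using card_independent_rows_le[OF d S0(1)] R(2) S0(2) 1 by simp
qed

section \<open>The anisotropic part\<close>

text \<open>The hypotheses on \<open>\<delta>\<close> and \<open>e\<close> turn qT into q^(d+e-1)
  and T/A into q^(e-1); cancelling \<open>A\<close> then gives the stated quotient.\<close>

lemma bound_powr:
  assumes d: "d \<ge> 1" and \<tau>: "real \<tau> = real q powr \<delta>" and e: "e = real n - 2 * real d + \<delta>"
  shows "metric_dimension (generators F) (dual_polar_adj F) \<le> incidence_rank F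
    \<and> real (metric_dimension (generators F) (dual_polar_adj F))
      \<le> ((real q powr (real d + e - 1) + 1) * (real q powr (real d + e - 1) - real q powr (e - 1) + real q - 1))
             / ((real q powr (e - 1) + 1) * (real q - 1))"
proof
  have q0: "real q > 0" using q_gt_1 by simp
  have Tp: "T = real q powr (\<delta> + real n - 2 - real d)"
    unfolding T_def \<tau> using q0 
    by (simp add: powr_diff powr_add powr_realpow field_simps)
  have Ap: "A = real q powr (real d - 1)"
    unfolding A_def using q0 by (simp add: powr_diff powr_realpow)
  have qT: "real q powr (real d + e - 1) = real q * T"
  proof -
    have "real q * T = real q powr 1 * real q powr (\<delta> + real n - 2 - real d)" using q0 by (simp add: Tp)
    also have "\<dots> = real q powr (real d + e - 1)"
      unfolding powr_add[symmetric] e by (rule arg_cong[where f="\<lambda>x. real q powr x"]) simp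
    finally show ?thesis ..
  qed
  have TA: "real q powr (e - 1) = T / A"
    unfolding Tp Ap powr_diff[symmetric] e by (rule arg_cong[where f="\<lambda>x. real q powr x"]) simp
  have "T * (real q * A - 1) + A * (real q - 1) = A * (real q * T - T / A + real q - 1)"
    "(real q - 1) * (T + A) = A * ((T / A + 1) * (real q - 1))"
    using A_pos by (simp_all add: field_simps)
  hence "(real q * T + 1) * (T * (real q * A - 1) + A * (real q - 1)) / ((real q - 1) * (T + A))
    = (real q * T + 1) * (A * (real q * T - T / A + real q - 1)) / (A * ((T / A + 1) * (real q - 1)))"
    by (simp only:)
  also have "\<dots> = (real q * T + 1) * (real q * T - T / A + real q - 1) / ((T / A + 1) * (real q - 1))"
    using A_pos by simp
  finally show "real (metric_dimension (generators F) (dual_polar_adj F))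
      \<le> ((real q powr (real d + e - 1) + 1) * (real q powr (real d + e - 1) - real q powr (e - 1) + real q - 1))
             / ((real q powr (e - 1) + 1) * (real q - 1))"
    unfolding qT TA using metric_dimension_le(2)[OF d] by simp
qed (rule metric_dimension_le(1)[OF d])

text \<open>For a generator \<open>U\<close>, the quotient of \<open>perp U\<close> by
  \<open>U\<close> is the anisotropic part of the form; its dimension is n - 2d.\<close>

definition perp :: "('n \<Rightarrow> 'a) set \<Rightarrow> ('n \<Rightarrow> 'a) set" where
  "perp U = {v. \<forall>u\<in>U. B v u = 0}"

lemma lsubspace_perp_set: "lsubspace (perp U)"
  by (rule fs.subspaceI) (auto simp: perp_def B_add B_scale)

lemma subset_perp: "U \<in> generators F \<Longrightarrow> U \<subseteq> perp U"
  using ti_generator by (auto simp: perp_def ti_def)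

lemma isotropic_perp: "U \<in> generators F \<Longrightarrow> w \<in> perp U \<Longrightarrow> w \<in> S \<Longrightarrow> w \<in> U"
  by (rule generator_maximal) (auto simp: perp_def dest: B_sym)

lemma card_perp_set: "U \<in> generators F \<Longrightarrow> card (perp U) * q ^ d = q ^ n"
  unfolding perp_def using card_ti_perp[OF ti_generator, of U] card_generator[of U] by simp

lemma dimension_ge: "2 * d \<le> n"
proof -
  obtain U where U: "U \<in> generators F" using ex_generator by blast
  have "q ^ d \<le> card (perp U)"
    unfolding card_generator[OF U, symmetric] by (intro card_mono subset_perp U) auto
  hence "q ^ d * q ^ d \<le> card (perp U) * q ^ d" by (rule mult_right_mono) simp
  hence "q ^ (2 * d) \<le> q ^ n" unfolding card_perp_set[OF U] by (simp add: mult_2 power_add)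
  thus ?thesis using q_gt_1 by simp
qed

lemma dimension_le:
  assumes U: "U \<in> generators F" and le: "card (perp U) \<le> q ^ k * card U"
  shows "n \<le> 2 * d + k"
proof -
  have "q ^ n \<le> q ^ k * card U * q ^ d"
    unfolding card_perp_set[OF U, symmetric] using le by (rule mult_right_mono) simp
  also have "\<dots> = q ^ (2 * d + k)"
    unfolding card_generator[OF U] by (simp add: power_add mult_2)
  finally show ?thesis using q_gt_1 by simp
qed

end

section \<open>Squares and norms in finite fields\<close>

lemma card_fibers:
  assumes "finite A" "\<And>a. a \<in> A \<Longrightarrow> card {x \<in> A. f x = f a} = k"
  shows "card A = card (f ` A) * k"
proof -
  have "card A = (\<Sum>y\<in>f ` A. card {x \<in> A. f x = y})"
    unfolding card_eq_sum by (rule sum.image_gen[OF assms(1)])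
  also have "\<dots> = (\<Sum>y\<in>f ` A. k)" using assms(2) by (intro sum.cong) auto
  finally show ?thesis by simp
qed

text \<open>Squaring is injective in characteristic 2, hence surjective by finiteness.\<close>

lemma char_2_square_surj:
  fixes c :: "'a::{field,finite}"
  assumes "(2::'a) = 0"
  shows "\<exists>b. b\<^sup>2 = c"
proof -
  have "inj (\<lambda>b::'a. b\<^sup>2)"
  proof (rule injI)
    fix a b :: 'a assume "a\<^sup>2 = b\<^sup>2"
    moreover have "(a - b)\<^sup>2 = a\<^sup>2 - b\<^sup>2 + 2 * (b * (b - a))"
      by (simp add: power2_eq_square algebra_simps)
    ultimately show "a = b" using assms by simp
  qed
  hence "surj (\<lambda>b::'a. b\<^sup>2)" by (rule finite_UNIV_inj_surj[rotated]) simp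
  thus ?thesis by (metis surjD)
qed

text \<open>Squaring is two-to-one on nonzero elements, and 0 is one more square.\<close>

lemma card_squares:
  assumes "(2::'a::{field,finite}) \<noteq> 0"
  shows "2 * card (range (\<lambda>b::'a. b\<^sup>2)) = CARD('a) + 1"
proof -
  let ?sq = "\<lambda>b::'a. b\<^sup>2"
  have "card {x \<in> UNIV - {0}. x\<^sup>2 = a\<^sup>2} = 2" if "a \<in> UNIV - {0}" for a :: 'a
  proof -
    have "a \<noteq> - a"
    proof
      assume "a = - a"
      hence "2 * a = 0" by (metis add.right_inverse mult_2)
      thus False using assms that by simp
    qed
    moreover have "{x \<in> UNIV - {0}. x\<^sup>2 = a\<^sup>2} = {a, - a}"
      using that by (auto simp: power2_eq_iff)
    ultimately show ?thesis by simp
  qed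
  hence fib: "card (UNIV - {0::'a}) = card (?sq ` (UNIV - {0})) * 2" by (intro card_fibers) auto
  have "range ?sq = insert 0 (?sq ` (UNIV - {0}))"
    by (auto simp: image_iff)
  moreover have "0 \<notin> ?sq ` (UNIV - {0})" by auto
  ultimately have "card (range ?sq) = Suc (card (?sq ` (UNIV - {0})))"
    by (simp only: card_insert_disjoint[OF finite] not_False_eq_True)
  moreover have "Suc (card (UNIV - {0::'a})) = CARD('a)" by (rule card_Suc_Diff1) auto
  ultimately show ?thesis using fib by linarith
qed

text \<open>Pigeonhole: the values of x a^2 and of z - y b^2 each fill (q+1)/2 elements, so they
  share one.\<close>

lemma sum_of_two_squares:
  fixes x y z :: "'a::{field,finite}"
  assumes 2: "(2::'a) \<noteq> 0" and "x \<noteq> 0" "y \<noteq> 0"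
  obtains a b where "x * a\<^sup>2 + y * b\<^sup>2 = z"
proof -
  let ?Q = "range (\<lambda>b::'a. b\<^sup>2)"
  let ?X = "(\<lambda>s. x * s) ` ?Q" and ?Y = "(\<lambda>s. z - y * s) ` ?Q"
  have "card ?X = card ?Q" "card ?Y = card ?Q"
    using assms by (auto intro!: card_image inj_onI)
  moreover have "card (?X \<union> ?Y) \<le> CARD('a)" by (rule card_mono) auto
  moreover have "card ?X + card ?Y = card (?X \<union> ?Y) + card (?X \<inter> ?Y)" by (rule card_Un_Int) auto
  ultimately have "card (?X \<inter> ?Y) \<noteq> 0" using card_squares[OF 2] by linarith
  then obtain v where "v \<in> ?X" "v \<in> ?Y" by (auto simp: card_eq_0_iff)
  from \<open>v \<in> ?X\<close> obtain a where a: "v = x * a\<^sup>2" by auto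
  from \<open>v \<in> ?Y\<close> obtain b where b: "v = z - y * b\<^sup>2" by auto
  have "x * a\<^sup>2 + y * b\<^sup>2 = z" unfolding trans[OF a[symmetric] b] by simp
  thus ?thesis by (rule that)
qed

locale involution =
  fixes \<sigma> :: "'a::{field,finite} \<Rightarrow> 'a"
  assumes involution: "field_involution \<sigma>"
begin

lemma add: "\<sigma> (a + b) = \<sigma> a + \<sigma> b" and mult: "\<sigma> (a * b) = \<sigma> a * \<sigma> b"
  and involutive: "\<sigma> (\<sigma> a) = a"
  using involution by (auto simp: field_involution_def)

lemma zero: "\<sigma> 0 = 0"
  by (metis add add.right_neutral add_left_cancel)

lemma uminus: "\<sigma> (- a) = - \<sigma> a" using add[of a "- a"] by (simp add: zero eq_neg_iff_add_eq_0 add.commute)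

lemma eq_0_iff: "\<sigma> a = 0 \<longleftrightarrow> a = 0" using involutive[of a] zero by metis

lemma one: "\<sigma> 1 = 1" using mult[of 1 1] eq_0_iff[of 1] by simp

lemma divide: "\<sigma> (a / b) = \<sigma> a / \<sigma> b"
proof (cases "b = 0")
  case False
  thus ?thesis using mult[of "a / b" b] by (simp add: eq_0_iff eq_divide_eq)
qed (simp add: zero)

definition fixed :: "'a set" where "fixed = {a. \<sigma> a = a}"

text \<open>A fibre of the trace is a coset of its kernel, which is \<open>fixed\<close> times any
  nonzero \<open>s\<close> with \<sigma> s = - s. This count gives \<open>\<tau>\<close> in the
  Hermitian case.\<close>

lemma card_trace_fiber:
  assumes t: "t \<in> fixed"
  shows "card {b. b + \<sigma> b = t} = card fixed"
proof -
  obtain b0 where "\<sigma> b0 \<noteq> b0" using involution by (auto simp: field_involution_def fun_eq_iff)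
  define s where "s = b0 - \<sigma> b0"
  have s: "\<sigma> s = - s" "s \<noteq> 0"
    using \<open>\<sigma> b0 \<noteq> b0\<close> add[of b0 "- \<sigma> b0"] by (auto simp: s_def uminus involutive)
  \<comment> \<open>A vanishing trace would give \<sigma> = -id; as \<sigma> 1 = 1, then -1 = 1 and
    \<sigma> would be the identity.\<close>
  have "\<exists>c. c + \<sigma> c \<noteq> 0"
  proof (rule ccontr)
    assume "\<not> ?thesis"
    hence "c + \<sigma> c = 0" for c by blast
    hence neg: "\<sigma> c = - c" for c by (simp add: eq_neg_iff_add_eq_0 add.commute)
    hence "(1::'a) = - 1" using one by metis
    hence "- b0 = b0" by (metis mult_1 mult_minus_left)
    with neg[of b0] \<open>\<sigma> b0 \<noteq> b0\<close> show False by simp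
  qed
  then obtain c where c: "c + \<sigma> c \<noteq> 0" by blast
  define b1 where "b1 = t * c / (c + \<sigma> c)"
  have "\<sigma> b1 = t * \<sigma> c / (c + \<sigma> c)"
    using t by (simp add: b1_def divide mult add involutive fixed_def add.commute)
  hence b1: "b1 + \<sigma> b1 = t"
    using c by (simp add: b1_def add_divide_distrib[symmetric] distrib_left[symmetric])
  have "bij_betw (\<lambda>a. a * s + b1) fixed {b. b + \<sigma> b = t}"
  proof (rule bij_betwI[where g="\<lambda>b. (b - b1) / s"])
    show "(\<lambda>a. a * s + b1) \<in> fixed \<rightarrow> {b. b + \<sigma> b = t}"
      using b1 s by (auto simp: fixed_def add mult algebra_simps)
    show "(\<lambda>b. (b - b1) / s) \<in> {b. b + \<sigma> b = t} \<rightarrow> fixed"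
    proof safe
      fix b assume "t = b + \<sigma> b"
      hence "\<sigma> b - \<sigma> b1 = b1 - b" using b1 by (simp add: algebra_simps)
      thus "(b - b1) / s \<in> fixed"
        using s add[of b "- b1"] by (simp add: fixed_def divide uminus minus_divide_left)
    qed
  qed (use s in auto)
  thus ?thesis by (rule bij_betw_same_card[symmetric])
qed

text \<open>The trace maps onto \<open>fixed\<close>, and its fibres have the size of
  \<open>fixed\<close>.\<close>

lemma card_eq_fixed_square: "CARD('a) = card fixed * card fixed"
proof -
  have trace_fixed: "b + \<sigma> b \<in> fixed" for b by (simp add: fixed_def add involutive add.commute)
  have "CARD('a) = card (range (\<lambda>b. b + \<sigma> b)) * card fixed"
    using card_trace_fiber[OF trace_fixed] by (intro card_fibers) auto
  moreover have "range (\<lambda>b. b + \<sigma> b) = fixed"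
  proof
    show "fixed \<subseteq> range (\<lambda>b. b + \<sigma> b)"
    proof
      fix t assume t: "t \<in> fixed"
      hence "card fixed \<noteq> 0" by (metis card_eq_0_iff empty_iff finite)
      hence "{b. b + \<sigma> b = t} \<noteq> {}" using card_trace_fiber[OF t] by (metis card.empty)
      thus "t \<in> range (\<lambda>b. b + \<sigma> b)" by auto
    qed
  qed (use trace_fixed in auto)
  ultimately show ?thesis by simp
qed

text \<open>By Hilbert 90, the norm-one group is the image of \<open>b \<mapsto> b / \<sigma> b\<close>, whose fibres are the
  cosets of the multiplicative group of the fixed field; comparing orders, the norm maps onto that
  group.\<close>
lemma norm_surj:
  assumes "t \<in> fixed"
  obtains a where "a * \<sigma> a = t"
proof (cases "t = 0")
  case True
  thus ?thesis using that[of 0] by simp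
next
  case False
  let ?G = "UNIV - {0 :: 'a}" and ?K = "{a. a * \<sigma> a = 1}" and ?f = "\<lambda>b. b / \<sigma> b"
  let ?N = "\<lambda>a. a * \<sigma> a"
  have "card {x \<in> ?G. ?f x = ?f b} = card (fixed - {0})" if b: "b \<in> ?G" for b
  proof (rule bij_betw_same_card[symmetric, OF bij_betwI[where f="\<lambda>a. a * b" and g="\<lambda>x. x / b"]])
    show "(\<lambda>a. a * b) \<in> fixed - {0} \<rightarrow> {x \<in> ?G. ?f x = ?f b}"
      using b by (auto simp: fixed_def mult eq_0_iff)
    show "(\<lambda>x. x / b) \<in> {x \<in> ?G. ?f x = ?f b} \<rightarrow> fixed - {0}"
      using b by (auto simp: fixed_def divide eq_0_iff field_simps)
  qed (use b in auto)
  hence "card ?G = card (?f ` ?G) * card (fixed - {0})" by (intro card_fibers) auto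
  also have "?f ` ?G = ?K"
  proof
    show "?f ` ?G \<subseteq> ?K" by (auto simp: divide involutive eq_0_iff)
    show "?K \<subseteq> ?f ` ?G"
    proof
      fix a assume a: "a \<in> ?K"
      \<comment> \<open>If all these sums vanished, c = 1 would give a = -1, and then \<sigma> would
        be the identity.\<close>
      have "\<exists>c. c + a * \<sigma> c \<noteq> 0"
      proof (rule ccontr)
        assume "\<not> ?thesis"
        hence *: "c + a * \<sigma> c = 0" for c by blast
        from *[of 1] have "a = - 1" by (simp add: one eq_neg_iff_add_eq_0 add.commute)
        with * have "\<sigma> = id" by (auto simp: fun_eq_iff)
        thus False using involution by (simp add: field_involution_def)
      qed
      then obtain c where c: "c + a * \<sigma> c \<noteq> 0" by blast
      let ?b = "c + a * \<sigma> c"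
      \<comment> \<open>Norm one makes \<open>?b\<close> a solution of a \<sigma>(b) = b.\<close>
      have "a * \<sigma> ?b = (a * \<sigma> a) * c + a * \<sigma> c" by (simp add: add mult involutive algebra_simps)
      hence "a * \<sigma> ?b = ?b" using a by simp
      moreover have "\<sigma> ?b \<noteq> 0" using c eq_0_iff by blast
      ultimately have "a = ?f ?b" by (simp add: eq_divide_eq)
      thus "a \<in> ?f ` ?G" using c by (intro image_eqI[of _ _ ?b]) auto
    qed
  qed
  finally have 1: "card ?G = card ?K * card (fixed - {0})" .
  have "card {x \<in> ?G. ?N x = ?N b} = card ?K" if b: "b \<in> ?G" for b
  proof (rule bij_betw_same_card[symmetric, OF bij_betwI[where f="\<lambda>a. a * b" and g="\<lambda>x. x / b"]])
    show "(\<lambda>a. a * b) \<in> ?K \<rightarrow> {x \<in> ?G. ?N x = ?N b}"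
    proof safe
      fix a assume a: "a * \<sigma> a = 1"
      have "(a * b) * \<sigma> (a * b) = (a * \<sigma> a) * (b * \<sigma> b)" by (simp add: mult)
      thus "(a * b) * \<sigma> (a * b) = b * \<sigma> b" using a by simp
    next
      fix a assume a: "a * \<sigma> a = 1" "a * b = 0"
      thus False using b by auto
    qed auto
    show "(\<lambda>x. x / b) \<in> {x \<in> ?G. ?N x = ?N b} \<rightarrow> ?K"
      using b by (auto simp: divide eq_0_iff)
  qed (use b in auto)
  hence 2: "card ?G = card (?N ` ?G) * card ?K" by (intro card_fibers) auto
  have "1 \<in> ?K" by (simp add: one)
  hence K: "card ?K \<noteq> 0" by (metis card_eq_0_iff empty_iff finite)
  have "card (?N ` ?G) * card ?K = card (fixed - {0}) * card ?K"
    unfolding 2[symmetric] 1 by (rule mult.commute)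
  hence "card (?N ` ?G) = card (fixed - {0})" by (rule mult_right_cancel[OF K, THEN iffD1])
  moreover have "?N ` ?G \<subseteq> fixed - {0}" by (auto simp: fixed_def mult involutive eq_0_iff)
  ultimately have "?N ` ?G = fixed - {0}" by (intro card_subset_eq finite)
  hence "t \<in> ?N ` ?G" using assms False by simp
  thus ?thesis using that by auto
qed

end

lemma card_less_obtain:
  fixes X :: "'b::finite set"
  assumes "card X < card Y"
  obtains y where "y \<in> Y" "y \<notin> X"
  using assms card_mono[of X Y] by (metis finite leD subsetI)

section \<open>The three types of polar spaces\<close>

lemma polar_space_symplectic:
  fixes B :: "('n::finite \<Rightarrow> 'a::{field,finite}) \<Rightarrow> ('n \<Rightarrow> 'a) \<Rightarrow> 'a"
  assumes "valid_form (Symplectic B)"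
  shows "polar_space (Symplectic B) B UNIV CARD('a) CARD('a) CARD('n)"
proof -
  have add: "B (u + v) w = B u w + B v w" "B u (v + w) = B u v + B u w"
    and scale: "B (fscale c u) v = c * B u v"
    and self: "B v v = 0" and nd: "(\<And>v. B u v = 0) \<Longrightarrow> u = 0" for u v w c
    using assms by (auto simp: sesquilinear_def nondegenerate_def)
  have alt: "B u v = - B v u" for u v
  proof -
    have "(B u u + B v u) + (B u v + B v v) = 0" using self[of "u + v"] by (simp only: add)
    thus ?thesis by (simp add: self eq_neg_iff_add_eq_0 add.commute)
  qed
  show ?thesis
  proof
    fix u v :: "'n \<Rightarrow> 'a"
    show "B v u = 0" if "B u v = 0" using that alt[of v u] by simp
    show "u = 0" if "\<And>v. B v u = 0" using that alt[of u] by (intro nd) simp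
  qed (auto simp: add scale self ti_subspaces_def)
qed

text \<open>Every vector is isotropic, so \<open>perp U\<close> lies in \<open>U\<close>.\<close>

lemma symplectic_dimension:
  fixes B :: "('n::finite \<Rightarrow> 'a::{field,finite}) \<Rightarrow> ('n \<Rightarrow> 'a) \<Rightarrow> 'a"
  assumes "valid_form (Symplectic B)"
  shows "CARD('n) \<le> 2 * witt_index (Symplectic B)"
proof -
  interpret polar_space "Symplectic B" B UNIV "CARD('a)" "CARD('a)" "CARD('n)"
    by (rule polar_space_symplectic[OF assms])
  obtain U where U: "U \<in> generators (Symplectic B)" using ex_generator by blast
  have "card (perp U) \<le> card U" using isotropic_perp[OF U] by (intro card_mono) auto
  thus ?thesis using dimension_le[OF U, of 0] by simp
qed

lemma polar_space_quadratic:
  fixes Q :: "('n::finite \<Rightarrow> 'a::{field,finite}) \<Rightarrow> 'a"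
  assumes "valid_form (Quadratic Q)"
  shows "polar_space (Quadratic Q) (polar_of Q) {v. Q v = 0} 1 CARD('a) CARD('n)"
proof -
  have add: "polar_of Q (u + v) w = polar_of Q u w + polar_of Q v w"
    and scale: "polar_of Q (fscale c u) v = c * polar_of Q u v"
    and Qscale: "Q (fscale c u) = c\<^sup>2 * Q u"
    and nd: "Q u = 0 \<Longrightarrow> (\<And>w. polar_of Q u w = 0) \<Longrightarrow> u = 0" for u v w c
    using assms by (auto simp: sesquilinear_def)
  have sym: "polar_of Q u v = polar_of Q v u" for u v
    by (simp add: polar_of_def add.commute)
  have Qadd: "Q (u + v) = Q u + Q v + polar_of Q u v" for u v
    by (simp add: polar_of_def)
  have Q0: "Q 0 = 0" using Qscale[of 0 0] by simp
  have self: "polar_of Q u u = 0" if "Q u = 0" for u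
  proof -
    have "u + u = fscale 2 u" by (auto simp: fscale_def fun_eq_iff)
    thus ?thesis using that by (simp add: polar_of_def Qscale)
  qed
  show ?thesis
  proof
    fix u v :: "'n \<Rightarrow> 'a"
    assume u: "u \<in> {v. Q v = 0}"
    show "u = 0" if "\<And>v. polar_of Q v u = 0"
      using that u sym by (intro nd) auto
    assume vu: "polar_of Q v u \<noteq> 0"
    \<comment> \<open>As Q u = 0, the form is affine in \<open>a\<close> with nonzero slope, so it
      has exactly one root.\<close>
    have "Q (v + fscale a u) = Q v + a * polar_of Q v u" for a
      using u by (simp add: Qadd Qscale sym[of v] scale)
    moreover have "Q v + a * polar_of Q v u = 0 \<longleftrightarrow> a = - Q v / polar_of Q v u" for a
      unfolding nonzero_eq_divide_eq[OF vu] by (simp add: eq_neg_iff_add_eq_0 add.commute)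
    ultimately have "{a. v + fscale a u \<in> {v. Q v = 0}} = {- Q v / polar_of Q v u}" by simp
    thus "card {a. v + fscale a u \<in> {v. Q v = 0}} = 1" by simp
  next
    show "ti_subspaces (Quadratic Q)
      = {W. lsubspace W \<and> W \<subseteq> {v. Q v = 0} \<and> (\<forall>u\<in>W. \<forall>v\<in>W. polar_of Q u v = 0)}"
      by (auto simp: ti_subspaces_def polar_of_def fs.subspace_add)
    show "polar_of Q v u = 0" if "polar_of Q u v = 0" for u v using that unfolding sym[of v u] .
  qed (simp_all add: add scale Qadd Qscale Q0 self)
qed

text \<open>An anisotropic quadratic form over a finite field has dimension at most 2. Otherwise
  \<open>perp U\<close> contains mutually perpendicular \<open>v\<close>, \<open>u\<close>,
  \<open>w\<close> outside \<open>U\<close>, each choice costing at most a factor q, and a suitable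
  combination is isotropic.\<close>

lemma quadratic_dimension:
  fixes Q :: "('n::finite \<Rightarrow> 'a::{field,finite}) \<Rightarrow> 'a"
  assumes valid: "valid_form (Quadratic Q)"
  shows "CARD('n) \<le> 2 * witt_index (Quadratic Q) + 2"
proof -
  interpret polar_space "Quadratic Q" "polar_of Q" "{v. Q v = 0}" 1 "CARD('a)" "CARD('n)"
    by (rule polar_space_quadratic[OF valid])
  let ?P = "polar_of Q" and ?q = "CARD('a)"
  have Qscale: "Q (fscale c u) = c\<^sup>2 * Q u" for c u using valid by simp
  have sym: "?P u v = ?P v u" for u v by (simp add: polar_of_def add.commute)
  have Qadd: "Q (u + v) = Q u + Q v + ?P u v" for u v by (simp add: polar_of_def)
  have self: "?P u u = 2 * Q u" for u
  proof -
    have "u + u = fscale 2 u" by (auto simp: fscale_def fun_eq_iff)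
    hence "?P u u = 2\<^sup>2 * Q u - Q u - Q u" by (simp add: polar_of_def Qscale)
    thus ?thesis by (simp add: power2_eq_square)
  qed
  obtain U where U: "U \<in> generators (Quadratic Q)" using ex_generator by blast
  have subU: "lsubspace U" using U by (rule lsubspace_generator)
  have aniso: "Q z = 0 \<Longrightarrow> z \<in> perp U \<Longrightarrow> z \<in> U" for z using isotropic_perp[OF U] by simp
  have "card (perp U) \<le> ?q ^ 2 * card U"
  proof (rule ccontr)
    assume "\<not> ?thesis"
    hence big: "?q * (?q * card U) < card (perp U)" by (simp add: power2_eq_square mult.assoc)
    let ?X = "\<lambda>v. {w \<in> perp U. ?P w v = 0}" and ?Y = "\<lambda>v u. {w \<in> {w \<in> perp U. ?P w v = 0}. ?P w u = 0}"
    have q1: "?q \<ge> 1" using q_gt_1 by simp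
    have "card U \<le> ?q * (?q * card U)" using q1 by simp
    hence "card U < card (perp U)" using big by linarith
    then obtain v where v: "v \<in> perp U" "v \<notin> U" by (rule card_less_obtain)
    have "?q * (?q * card U) < ?q * card (?X v)"
      using big card_perp_ge[OF lsubspace_perp_set, of U v] by linarith
    hence X: "?q * card U < card (?X v)" using q1 by simp
    \<comment> \<open>\<open>u\<close> has to avoid the span of \<open>U\<close> and
      \<open>v\<close>, since in characteristic 2 the contradiction is u + b v in
      \<open>U\<close>.\<close>
    hence "card (lext U v) < card (?X v)" by (simp only: card_lext'[OF subU v(2)])
    then obtain u where "u \<in> ?X v" and u': "u \<notin> lext U v" by (rule card_less_obtain)
    with u' have u: "u \<in> perp U" "?P u v = 0" "u \<notin> lext U v" by auto
    have "?q * card U < ?q * card (?Y v u)"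
      using X card_perp_ge[OF lsubspace_perp[OF lsubspace_perp_set], of U v u] by linarith
    hence "card U < card (?Y v u)" using q1 by simp
    then obtain w where "w \<in> ?Y v u" and w': "w \<notin> U" by (rule card_less_obtain)
    with w' have w: "w \<in> perp U" "?P w v = 0" "?P w u = 0" "w \<notin> U" by auto
    have "u \<notin> U" using u(3) subset_lext by blast
    hence Qv: "Q v \<noteq> 0" and Qu: "Q u \<noteq> 0" using aniso u v by blast+
    have comb: "x + fscale a y \<in> perp U" if "x \<in> perp U" "y \<in> perp U" for x y a
      using that by (intro fs.subspace_add fs.subspace_scale lsubspace_perp_set)
    show False
    proof (cases "(2::'a) = 0")
      case True
      obtain b where b: "b\<^sup>2 = - Q u / Q v" using char_2_square_surj[OF True] by blast
      have "?P u (fscale b v) = 0" using u(2) by (simp add: B_scale_right)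
      hence "Q (u + fscale b v) = 0" using Qv b by (simp add: Qadd Qscale)
      hence "u + fscale b v \<in> U" using aniso comb u v by blast
      moreover have "u = (u + fscale b v) + fscale (- b) v" by simp
      ultimately have "u \<in> lext U v" unfolding mem_lext by blast
      with u(3) show False ..
    next
      case False
      obtain a b where ab: "Q u * a\<^sup>2 + Q v * b\<^sup>2 = - Q w"
        using sum_of_two_squares[OF False Qu Qv] by blast
      let ?z = "(w + fscale a u) + fscale b v"
      have "?P w (fscale a u) = 0" using w(3) by (simp add: B_scale_right)
      moreover have "?P (w + fscale a u) (fscale b v) = 0"
        unfolding B_scale_right using w(2) u(2) by (simp add: B_add B_scale)
      ultimately have "Q ?z = Q w + (Q u * a\<^sup>2 + Q v * b\<^sup>2)" by (simp add: Qadd Qscale mult.commute)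
      hence "Q ?z = 0" unfolding ab by simp
      hence zU: "?z \<in> U" by (intro aniso comb w(1) u(1) v(1))
      \<comment> \<open>An isotropic \<open>?z\<close> lies in \<open>U\<close>; pairing it with
        \<open>u\<close> and \<open>v\<close> forces a = b = 0 because 2 is invertible, and puts
        \<open>w\<close> into \<open>U\<close>.\<close>
      have "?P ?z u = 0" "?P ?z v = 0" using zU u(1) v(1) sym by (auto simp: perp_def)
      moreover have "?P v u = 0" using u(2) sym by simp
      hence "?P ?z u = a * (2 * Q u)" using w(3) by (simp add: B_add B_scale self)
      moreover have "?P ?z v = b * (2 * Q v)" using w(2) u(2) by (simp add: B_add B_scale self)
      ultimately have "a = 0" "b = 0" using False Qu Qv by auto
      with zU w(4) show False by simp
    qed
  qed
  thus ?thesis by (rule dimension_le[OF U])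
qed

lemma hermitian_sym: "valid_form (Hermitian \<sigma> h) \<Longrightarrow> h v u = \<sigma> (h u v)"
  unfolding valid_form.simps by (elim conjE allE)

lemma polar_space_hermitian:
  fixes h :: "('n::finite \<Rightarrow> 'a::{field,finite}) \<Rightarrow> ('n \<Rightarrow> 'a) \<Rightarrow> 'a"
  assumes valid: "valid_form (Hermitian \<sigma> h)"
  shows "polar_space (Hermitian \<sigma> h) h {v. h v v = 0} (card {a. \<sigma> a = a}) CARD('a) CARD('n)"
proof -
  interpret involution \<sigma> using valid unfolding valid_form.simps by unfold_locales blast
  have ses: "sesquilinear \<sigma> h" and nondeg: "nondegenerate h"
    using valid unfolding valid_form.simps by blast+
  have h_add: "h (u + v) w = h u w + h v w" "h u (v + w) = h u v + h u w"
    and h_scale: "h (fscale c u) v = c * h u v" "h u (fscale c v) = \<sigma> c * h u v" for u v w c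
    using ses by (auto simp: sesquilinear_def)
  have nd: "(\<And>v. h u v = 0) \<Longrightarrow> u = 0" for u
    using nondeg by (auto simp: nondegenerate_def)
  have h_zero: "h 0 0 = 0" using h_scale(1)[of 0 0 0] by simp
  note herm = hermitian_sym[OF valid]
  have sym: "h v u = 0" if "h u v = 0" for u v using that herm[of v u] by (simp add: zero)
  show ?thesis
  proof
    fix u v :: "'n \<Rightarrow> 'a"
    show "h v u = 0" if "h u v = 0" using that by (rule sym)
    assume u: "u \<in> {v. h v v = 0}"
    show "u = 0" if "\<And>v. h v u = 0" by (rule nd[OF sym[OF that]])
    show "u + v \<in> {v. h v v = 0}" if "v \<in> {v. h v v = 0}" "h u v = 0"
      using that u sym[of u v] by (simp add: h_add)
    assume vu: "h v u \<noteq> 0"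
    have hh: "h (v + fscale a u) (v + fscale a u) = h v v + (\<sigma> a * h v u + \<sigma> (\<sigma> a * h v u))" for a
      using u herm[of u v] by (simp add: h_add h_scale mult involutive add.assoc)
    \<comment> \<open>With b = \<sigma> a h(v,u), isotropy becomes the trace equation b + \<sigma> b
      = -h(v,v), whose solutions are already counted.\<close>
    have "bij_betw (\<lambda>a. \<sigma> a * h v u) {a. v + fscale a u \<in> {v. h v v = 0}} {b. b + \<sigma> b = - h v v}"
    proof (rule bij_betwI[where g="\<lambda>b. \<sigma> (b / h v u)"])
      show "(\<lambda>a. \<sigma> a * h v u) \<in> {a. v + fscale a u \<in> {v. h v v = 0}} \<rightarrow> {b. b + \<sigma> b = - h v v}"
        by (auto simp: hh eq_neg_iff_add_eq_0 add.commute)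
      show "(\<lambda>b. \<sigma> (b / h v u)) \<in> {b. b + \<sigma> b = - h v v} \<rightarrow> {a. v + fscale a u \<in> {v. h v v = 0}}"
        using vu by (auto simp: hh involutive)
    qed (use vu in \<open>auto simp: involutive\<close>)
    hence "card {a. v + fscale a u \<in> {v. h v v = 0}} = card {b. b + \<sigma> b = - h v v}"
      by (rule bij_betw_same_card)
    moreover have "- h v v \<in> fixed" using herm[of v v] by (simp add: fixed_def uminus)
    ultimately show "card {a. v + fscale a u \<in> {v. h v v = 0}} = card {a. \<sigma> a = a}"
      by (simp only: card_trace_fiber fixed_def[symmetric])
  qed (auto simp: h_add h_scale h_zero ti_subspaces_def)
qed

text \<open>An anisotropic Hermitian form over a finite field has dimension at most 1: for
  perpendicular \<open>u\<close> and \<open>v\<close>, surjectivity of the norm supplies an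
  isotropic u + a v.\<close>

lemma hermitian_dimension:
  fixes h :: "('n::finite \<Rightarrow> 'a::{field,finite}) \<Rightarrow> ('n \<Rightarrow> 'a) \<Rightarrow> 'a"
  assumes valid: "valid_form (Hermitian \<sigma> h)"
  shows "CARD('n) \<le> 2 * witt_index (Hermitian \<sigma> h) + 1"
proof -
  interpret involution \<sigma> using valid unfolding valid_form.simps by unfold_locales blast
  interpret polar_space "Hermitian \<sigma> h" h "{v. h v v = 0}" "card {a. \<sigma> a = a}" "CARD('a)" "CARD('n)"
    by (rule polar_space_hermitian[OF valid])
  let ?q = "CARD('a)"
  have ses: "sesquilinear \<sigma> h" using valid unfolding valid_form.simps by blast
  have h_add: "h u (v + w) = h u v + h u w" and h_scale: "h u (fscale c v) = \<sigma> c * h u v" for u v w c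
    using ses by (auto simp: sesquilinear_def)
  note herm = hermitian_sym[OF valid]
  obtain U where U: "U \<in> generators (Hermitian \<sigma> h)" using ex_generator by blast
  have aniso: "h z z = 0 \<Longrightarrow> z \<in> perp U \<Longrightarrow> z \<in> U" for z using isotropic_perp[OF U] by simp
  have "card (perp U) \<le> ?q ^ 1 * card U"
  proof (rule ccontr)
    assume "\<not> ?thesis"
    hence big: "?q * card U < card (perp U)" by simp
    let ?X = "\<lambda>v. {w \<in> perp U. h w v = 0}"
    have q1: "?q \<ge> 1" using q_gt_1 by simp
    have "card U \<le> ?q * card U" using q1 by simp
    hence "card U < card (perp U)" using big by linarith
    then obtain v where v: "v \<in> perp U" "v \<notin> U" by (rule card_less_obtain)
    have "?q * card U < ?q * card (?X v)"
      using big card_perp_ge[OF lsubspace_perp_set, of U v] by linarith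
    hence "card U < card (?X v)" using q1 by simp
    then obtain u where "u \<in> ?X v" and u': "u \<notin> U" by (rule card_less_obtain)
    with u' have u: "u \<in> perp U" "h u v = 0" "u \<notin> U" by auto
    have hv: "h v v \<noteq> 0" using aniso v by blast
    have "- h u u / h v v \<in> fixed"
      using herm[of u u] herm[of v v] by (simp add: fixed_def divide uminus)
    then obtain a where a: "a * \<sigma> a = - h u u / h v v" by (rule norm_surj)
    let ?z = "u + fscale a v"
    have "h v u = 0" using u(2) by (rule B_sym)
    hence "h ?z ?z = h u u + a * \<sigma> a * h v v"
      using u(2) by (simp add: B_add B_scale h_add h_scale)
    hence "h ?z ?z = 0" using hv a by simp
    moreover have "?z \<in> perp U"
      using u v by (intro fs.subspace_add fs.subspace_scale lsubspace_perp_set)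
    ultimately have "?z \<in> U" by (rule aniso)
    \<comment> \<open>As \<open>?z\<close> lies in \<open>U\<close>, pairing with \<open>v\<close>
      forces a = 0 and hence \<open>u\<close> in \<open>U\<close>.\<close>
    hence "h v ?z = 0" using v(1) by (simp add: perp_def)
    hence "h ?z v = 0" by (rule B_sym)
    hence "a = 0" using u(2) hv by (simp add: B_add B_scale)
    with \<open>?z \<in> U\<close> u(3) show False by simp
  qed
  thus ?thesis by (rule dimension_le[OF U])
qed

lemma hermitian_fixed_field:
  assumes "valid_form (Hermitian \<sigma> (h :: ('n \<Rightarrow> 'a::{field,finite}) \<Rightarrow> _))"
  shows "real (card {a. \<sigma> a = a}) = real CARD('a) powr (1 / 2)"
proof -
  interpret involution \<sigma> using assms unfolding valid_form.simps by unfold_locales blast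
  show ?thesis using card_eq_fixed_square by (simp add: powr_half_sqrt fixed_def)
qed

theorem theorem2p3:
  fixes F :: "('a::{field,finite}, 'n::finite) polar_form"
  assumes "valid_form F"
    and "witt_index F \<ge> 1"
  shows "metric_dimension (generators F) (dual_polar_adj F) \<le> incidence_rank F
    \<and> (let q = real (CARD('a)); d = real (witt_index F); e = polar_e F in
         real (metric_dimension (generators F) (dual_polar_adj F))
           \<le> ((q powr (d + e - 1) + 1) * (q powr (d + e - 1) - q powr (e - 1) + q - 1))
             / ((q powr (e - 1) + 1) * (q - 1)))"
proof (cases F)
  case (Symplectic B)
  note valid = assms(1)[unfolded Symplectic]
  interpret polar_space F B UNIV "CARD('a)" "CARD('a)" "CARD('n)"
    unfolding Symplectic by (rule polar_space_symplectic[OF valid])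
  \<comment> \<open>Here \<tau> = q, so \<delta> = 1, and n = 2d makes the exponent agree with the
    constant value 1 of \<open>polar_e\<close>.\<close>
  have "CARD('n) = 2 * d"
    using dimension_ge symplectic_dimension[OF valid] unfolding Symplectic by linarith
  thus ?thesis unfolding Let_def
    using q_gt_1 by (intro bound_powr[OF assms(2), of 1]) (simp_all add: Symplectic)
next
  case (Quadratic Q)
  note valid = assms(1)[unfolded Quadratic]
  interpret polar_space F "polar_of Q" "{v. Q v = 0}" 1 "CARD('a)" "CARD('n)"
    unfolding Quadratic by (rule polar_space_quadratic[OF valid])
  \<comment> \<open>With \<delta> = 0 the parameter must be n - 2d; the last branch of
    \<open>polar_e\<close> is right because only n = 2d + 2 remains there.\<close>
  have "CARD('n) = 2 * d \<or> CARD('n) = 2 * d + 1 \<or> CARD('n) = 2 * d + 2"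
    using dimension_ge quadratic_dimension[OF valid] unfolding Quadratic by linarith
  hence "polar_e F = real CARD('n) - 2 * real d" by (auto simp: Quadratic)
  thus ?thesis unfolding Let_def
    using q_gt_1 by (intro bound_powr[OF assms(2), of 0]) simp_all
next
  case (Hermitian \<sigma> h)
  note valid = assms(1)[unfolded Hermitian]
  interpret polar_space F h "{v. h v v = 0}" "card {a. \<sigma> a = a}" "CARD('a)" "CARD('n)"
    unfolding Hermitian by (rule polar_space_hermitian[OF valid])
  \<comment> \<open>The fixed field has \<surd>q elements, so \<delta> = 1/2, and the second branch
    of \<open>polar_e\<close> is exactly n = 2d.\<close>
  have "CARD('n) = 2 * d \<or> CARD('n) = 2 * d + 1"
    using dimension_ge hermitian_dimension[OF valid] unfolding Hermitian by linarith
  hence "polar_e F = real CARD('n) - 2 * real d + 1 / 2" by (auto simp: Hermitian)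
  thus ?thesis unfolding Let_def
    by (intro bound_powr[OF assms(2), of "1 / 2"] hermitian_fixed_field[OF valid])
qed

end
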